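(* Let $\Lambda\ge\lambda>0$ and set $\omega=\Lambda/\lambda\ge 1$. Let $\frac{1}{\sqrt\omega}\le\gamma\le\sqrt\omega$ and $a\in\mathbb{R}$ with $|a|<\pi$. Let $\Omega^\omega_\gamma$ and $u^\omega_\gamma$ be as defined in the context, let $C_a$ be the linear map of $\mathbb{R}^2$ given by the matrix $C_a=\begin{pmatrix}\sqrt{1-(a/\pi)^2} & 0\\ a/\pi & 1\end{pmatrix}$, and set $\Omega^\omega_{\gamma,a}=C_a(\Omega^\omega_\gamma)$ and $u^\omega_{\gamma,a}(x,y)=u^\omega_\gamma(C_a^{-1}(x,y))$ for $(x,y)\in\Omega^\omega_{\gamma,a}$. Then $$-\mathcal{M}^+_{\lambda,\Lambda}(D^2u^\omega_{\gamma,a})\ge\frac{\lambda\pi^2}{\pi^2-a^2}\,u^\omega_{\gamma,a}\ \text{in }\Omega^\omega_{\gamma,a},\qquad u^\omega_{\gamma,a}>0\ \text{in }\Omega^\omega_{\gamma,a},\qquad u^\omega_{\gamma,a}=0\ \text{on }\partial\Omega^\omega_{\gamma,a}.$$ Consequently the positive principal eigenvalue of $\mathcal{M}^+_{\lambda,\Lambda}$ in $\Omega^\omega_{\gamma,a}$ satisfies $\mu(\Omega^\omega_{\gamma,a})\ge\frac{\lambda\pi^2}{\pi^2-a^2}$, with equality if and only if either $\omega=1$ or $a=0$.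
   Context: For $0<\lambda\le\Lambda$, the Pucci supremum operator is defined on $2\times 2$ real symmetric matrices $X$ by $\mathcal{M}^+_{\lambda,\Lambda}(X)=\lambda\sum_{e_i<0}e_i+\Lambda\sum_{e_i>0}e_i$, where $e_i$ are the eigenvalues of $X$. For a bounded Lipschitz domain $\Omega$, the positive principal eigenvalue is $\mu(\Omega)=\sup\{\mu\in\mathbb{R}:\exists\,\phi>0\text{ in }\Omega,\ \mathcal{M}^+_{\lambda,\Lambda}(D^2\phi)+\mu\phi\le 0\text{ in }\Omega\}$ (in the viscosity sense). For $\omega\ge1$ and $\frac{1}{\sqrt\omega}\le\gamma\le\sqrt\omega$, $\phi^\omega_\gamma$ is the even function on $|x|\le \frac{\pi}{2}+\sqrt\omega\arcsin\left(\frac{1}{\gamma\sqrt\omega}\right)$ given by $\phi^\omega_\gamma(x)=\frac{\pi}{2}+\sqrt\omega\arcsin\left(\frac{\gamma}{\sqrt\omega}\cos x\right)$ for $|x|\le\frac{\pi}{2}$ and $\phi^\omega_\gamma(x)=\arccos\left(\gamma\sqrt\omega\sin\left(\frac{|x|-\pi/2}{\sqrt\omega}\right)\right)$ for $\frac{\pi}{2}<|x|\le\frac{\pi}{2}+\sqrt\omega\arcsin\left(\frac{1}{\gamma\sqrt\omega}\right)$; $\Omega^\omega_\gamma=\{(x,y):|y|<\phi^\omega_\gamma(x)\}$; and $u^\omega_\gamma$ on $\overline{\Omega^\omega_\gamma}$ is given by $u^\omega_\gamma(x,y)=\gamma\cos x+\cos y$ if $|x|,|y|\le\frac{\pi}{2}$;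 $u^\omega_\gamma(x,y)=\gamma\sqrt\omega\cos\left(\frac{|x|-\pi/2}{\sqrt\omega}+\frac{\pi}{2}\right)+\cos y$ if $|x|\ge\frac{\pi}{2}$; $u^\omega_\gamma(x,y)=\gamma\cos x+\sqrt\omega\cos\left(\frac{|y|-\pi/2}{\sqrt\omega}+\frac{\pi}{2}\right)$ if $|y|\ge\frac{\pi}{2}$. *)

theory Defs
  imports "HOL-Analysis.Analysis"
begin

text \<open>A symmetric matrix [[p,q],[q,r]] is represented by its entries p q r.
  Its two eigenvalues (with multiplicity) are the roots of
  t^2 - (p+r) t + (p r - q^2), namely the two values below.\<close>

definition sym2_eig_lo :: "real \<Rightarrow> real \<Rightarrow> real \<Rightarrow> real" where
  "sym2_eig_lo p q r = ((p + r) - sqrt ((p - r)\<^sup>2 + 4 * q\<^sup>2)) / 2"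

definition sym2_eig_hi :: "real \<Rightarrow> real \<Rightarrow> real \<Rightarrow> real" where
  "sym2_eig_hi p q r = ((p + r) + sqrt ((p - r)\<^sup>2 + 4 * q\<^sup>2)) / 2"

definition pucci_weight :: "real \<Rightarrow> real \<Rightarrow> real \<Rightarrow> real" where
  "pucci_weight lam Lam e = (if e < 0 then lam * e else if e > 0 then Lam * e else 0)"

definition pucci_plus :: "real \<Rightarrow> real \<Rightarrow> real \<Rightarrow> real \<Rightarrow> real \<Rightarrow> real" where
  "pucci_plus lam Lam p q r =
     pucci_weight lam Lam (sym2_eig_lo p q r) + pucci_weight lam Lam (sym2_eig_hi p q r)"

definition pdx :: "(real \<times> real \<Rightarrow> real) \<Rightarrow> real \<times> real \<Rightarrow> real" where
  "pdx f z = deriv (\<lambda>t. f (t, snd z)) (fst z)"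

definition pdy :: "(real \<times> real \<Rightarrow> real) \<Rightarrow> real \<times> real \<Rightarrow> real" where
  "pdy f z = deriv (\<lambda>t. f (fst z, t)) (snd z)"

definition has_partials_on :: "(real \<times> real \<Rightarrow> real) \<Rightarrow> (real \<times> real) set \<Rightarrow> bool" where
  "has_partials_on f U \<longleftrightarrow>
     (\<forall>z\<in>U. (\<lambda>t. f (t, snd z)) differentiable (at (fst z)) \<and>
             (\<lambda>t. f (fst z, t)) differentiable (at (snd z)))"

definition C2_on :: "(real \<times> real) set \<Rightarrow> (real \<times> real \<Rightarrow> real) \<Rightarrow> bool" where
  "C2_on U f \<longleftrightarrow>
     has_partials_on f U \<and> has_partials_on (pdx f) U \<and> has_partials_on (pdy f) U \<and>
     continuous_on U f \<and> continuous_on U (pdx f) \<and> continuous_on U (pdy f) \<and>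
     continuous_on U (pdx (pdx f)) \<and> continuous_on U (pdy (pdx f)) \<and>
     continuous_on U (pdx (pdy f)) \<and> continuous_on U (pdy (pdy f))"

definition pucci_hess :: "real \<Rightarrow> real \<Rightarrow> (real \<times> real \<Rightarrow> real) \<Rightarrow> real \<times> real \<Rightarrow> real" where
  "pucci_hess lam Lam f z = pucci_plus lam Lam (pdx (pdx f) z) (pdy (pdx f) z) (pdy (pdy f) z)"

definition visc_supersol ::
  "real \<Rightarrow> real \<Rightarrow> real \<Rightarrow> (real \<times> real) set \<Rightarrow> (real \<times> real \<Rightarrow> real) \<Rightarrow> bool" where
  "visc_supersol lam Lam mu \<Omega> u \<longleftrightarrow>
     (\<forall>z0\<in>\<Omega>. \<forall>psi. \<forall>r>0.
        C2_on (ball z0 r) psi \<longrightarrow>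
        (\<forall>z\<in>\<Omega> \<inter> ball z0 r. u z - psi z \<ge> u z0 - psi z0) \<longrightarrow>
        pucci_hess lam Lam psi z0 + mu * u z0 \<le> 0)"

text \<open>Positive principal eigenvalue, as an extended real (supremum is taken in ereal,
  so it is meaningful regardless of boundedness of the set).\<close>
definition principal_eig :: "real \<Rightarrow> real \<Rightarrow> (real \<times> real) set \<Rightarrow> ereal" where
  "principal_eig lam Lam \<Omega> =
     Sup (ereal ` {mu. \<exists>phi. continuous_on \<Omega> phi \<and> (\<forall>z\<in>\<Omega>. phi z > 0) \<and>
                             visc_supersol lam Lam mu \<Omega> phi})"

definition Lbound :: "real \<Rightarrow> real \<Rightarrow> real" where
  "Lbound w g = pi / 2 + sqrt w * arcsin (1 / (g * sqrt w))"

definition phiwg :: "real \<Rightarrow> real \<Rightarrow> real \<Rightarrow> real" where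
  "phiwg w g x =
     (if \<bar>x\<bar> \<le> pi / 2 then pi / 2 + sqrt w * arcsin (g / sqrt w * cos x)
      else arccos (g * sqrt w * sin ((\<bar>x\<bar> - pi / 2) / sqrt w)))"

definition Omega_wg :: "real \<Rightarrow> real \<Rightarrow> (real \<times> real) set" where
  "Omega_wg w g = {(x, y). \<bar>x\<bar> \<le> Lbound w g \<and> \<bar>y\<bar> < phiwg w g x}"

definition u_wg :: "real \<Rightarrow> real \<Rightarrow> real \<times> real \<Rightarrow> real" where
  "u_wg w g z = (let x = fst z; y = snd z in
     if \<bar>x\<bar> \<le> pi / 2 \<and> \<bar>y\<bar> \<le> pi / 2 then g * cos x + cos y
     else if \<bar>x\<bar> \<ge> pi / 2 then g * sqrt w * cos ((\<bar>x\<bar> - pi / 2) / sqrt w + pi / 2) + cos y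
     else g * cos x + sqrt w * cos ((\<bar>y\<bar> - pi / 2) / sqrt w + pi / 2))"

definition Cmap :: "real \<Rightarrow> real \<times> real \<Rightarrow> real \<times> real" where
  "Cmap a z = (sqrt (1 - (a / pi)\<^sup>2) * fst z, a / pi * fst z + snd z)"

definition Cmap_inv :: "real \<Rightarrow> real \<times> real \<Rightarrow> real \<times> real" where
  "Cmap_inv a z = (fst z / sqrt (1 - (a / pi)\<^sup>2),
                   snd z - a / pi * fst z / sqrt (1 - (a / pi)\<^sup>2))"

definition Omega_wga :: "real \<Rightarrow> real \<Rightarrow> real \<Rightarrow> (real \<times> real) set" where
  "Omega_wga w g a = Cmap a ` Omega_wg w g"

definition u_wga :: "real \<Rightarrow> real \<Rightarrow> real \<Rightarrow> real \<times> real \<Rightarrow> real" where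
  "u_wga w g a z = u_wg w g (Cmap_inv a z)"

end

theory Submission
  imports Defs
begin

text \<open>In sheared coordinates \<open>(x, y)\<close> the function is \<open>U = g f(x) + f(y)\<close>, where \<open>f\<close> is a \<open>C\<^sup>2\<close>
  profile whose second derivative has Pucci weight exactly \<open>- \<lambda> f\<close>. Both coordinate covectors have
  squared norm \<open>1/c\<^sup>2 = \<pi>\<^sup>2/(\<pi>\<^sup>2 - a\<^sup>2)\<close>, so subadditivity of the Pucci operator makes \<open>U\<close> a
  supersolution. If \<open>\<omega> = 1\<close> (linear operator) or \<open>a = 0\<close> (orthogonal covectors) it is a solution,
  and comparison with shrunk copies of \<open>U\<close> bounds the eigenvalue from above. Otherwise subadditivity
  is strict wherever \<open>f(x)\<close> and \<open>f(y)\<close> have opposite signs, but not in the central square, where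
  both are nonnegative; there one gains from the rotation invariance of the Pucci operator, by
  averaging two slightly rotated copies of \<open>U\<close>.\<close>

section \<open>The Pucci operator\<close>

text \<open>On the central square the Hessian of \<open>U\<close> is negative semidefinite, the
  operator acts as \<lambda> times the trace, and \<open>U\<close> solves the equation with no
  slack, so the strictness found outside cannot simply be spread inwards. What helps is the pair of
  maps z \<mapsto> z \<plusminus> \<tau> Jz, with J the quarter turn. Each is a rotation times a
  dilation by sqrt(1 + \<tau>^2), and this dilation raises the eigenvalue; yet the two displacements
  average to zero. Hence near a zero of \<open>f\<close>, where \<open>f\<close> is linear up to
  second order, the averaged function hardly notices the dilation, and shrinking the argument by a
  smaller multiple of \<tau>^2 secures positivity while part of the gain survives. The corners of
  the square are the decisive points: in the closed square \<open>U\<close> vanishes only there, and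
  the rest of the boundary lies outside, where a bump is available. Away from the corners the
  rotation costs a multiple of \<tau>, which is paid by making the bump a large fixed multiple of
  \<tau>.\<close>

lemma pucci_weight_eq: "pucci_weight lam Lam e = lam * e + (Lam - lam) * max 0 e"
  by (simp add: pucci_weight_def algebra_simps)

text \<open>The positive parts of two eigenvalues sum to the largest of 0, the larger eigenvalue and
  the trace. The operator thus becomes a trace plus a maximum of sublinear functions, so that
  subadditivity and continuity can be read off without splitting on signs.\<close>

lemma pucci_plus_eq:
  "pucci_plus lam Lam p q r
    = lam * (p + r) + (Lam - lam) * max 0 (max (sym2_eig_hi p q r) (p + r))"
proof -
  have s: "sym2_eig_lo p q r = p + r - sym2_eig_hi p q r"
    and le: "sym2_eig_lo p q r \<le> sym2_eig_hi p q r"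
    by (simp_all add: sym2_eig_lo_def sym2_eig_hi_def field_simps)
  have "max 0 (sym2_eig_lo p q r) + max 0 (sym2_eig_hi p q r)
      = max 0 (max (sym2_eig_hi p q r) (p + r))"
    using le s by linarith
  from this[symmetric] show ?thesis
    unfolding pucci_plus_def pucci_weight_eq by (simp add: s algebra_simps)
qed

text \<open>The larger eigenvalue is half the trace plus half the Euclidean norm of (p - r, 2q), so
  this is the triangle inequality in the plane.\<close>

lemma sym2_eig_hi_subadd:
  "sym2_eig_hi (p + p') (q + q') (r + r') \<le> sym2_eig_hi p q r + sym2_eig_hi p' q' r'"
  using real_sqrt_sum_squares_triangle_ineq[of "p - r" "p' - r'" "2 * q" "2 * q'"]
  unfolding distrib_left[symmetric] power_mult_distrib
  by (simp add: sym2_eig_hi_def field_simps diff_add_eq add_diff_eq)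

lemma pucci_plus_subadd:
  assumes "lam \<le> Lam"
  shows "pucci_plus lam Lam (p + p') (q + q') (r + r')
    \<le> pucci_plus lam Lam p q r + pucci_plus lam Lam p' q' r'"
proof -
  have "max 0 (max (sym2_eig_hi (p + p') (q + q') (r + r')) (p + p' + (r + r')))
    \<le> max 0 (max (sym2_eig_hi p q r) (p + r)) + max 0 (max (sym2_eig_hi p' q' r') (p' + r'))"
    using sym2_eig_hi_subadd[of p p' q q' r r'] by linarith
  from mult_left_mono[OF this, of "Lam - lam"] assms show ?thesis
    by (simp add: pucci_plus_eq algebra_simps)
qed

text \<open>The hypothesis is a quadratic form because that is what a second-order condition at a
  minimum delivers. It is tested at a few vectors to get a nonnegative diagonal and
  determinant.\<close>

lemma pucci_plus_nonpos:
  assumes "0 \<le> lam" "lam \<le> Lam" and psd: "\<And>e1 e2. 0 \<le> p * e1\<^sup>2 + 2 * q * e1 * e2 + r * e2\<^sup>2"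
  shows "pucci_plus lam Lam (- p) (- q) (- r) \<le> 0"
proof -
  have p: "0 \<le> p" and r: "0 \<le> r" using psd[of 1 0] psd[of 0 1] by auto
  have "q\<^sup>2 \<le> p * r"
  proof (cases "p = 0")
    case True
    have "q = 0"
    proof (rule ccontr)
      assume "q \<noteq> 0"
      \<comment> \<open>With \<open>p = 0\<close> the form at this vector equals -1.\<close>
      with psd[of "- (r + 1) / (2 * q)" 1] True show False by simp
    qed
    then show ?thesis using True by simp
  next
    case False
    have "0 \<le> p * (p * r - q\<^sup>2)"
      \<comment> \<open>The vector (-q, p) is a column of the adjugate up to sign; on it the form is
        p times the determinant.\<close>
      using psd[of "- q" p] by (simp add: power2_eq_square algebra_simps)
    with False p show ?thesis by (simp add: zero_le_mult_iff)
  qed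
  then have "(p - r)\<^sup>2 + 4 * q\<^sup>2 \<le> (p + r)\<^sup>2" by (simp add: power2_eq_square algebra_simps)
  then have "sqrt ((p - r)\<^sup>2 + 4 * q\<^sup>2) \<le> p + r" using p r by (simp add: real_le_lsqrt)
  then have "sym2_eig_hi (- p) (- q) (- r) \<le> 0"
    by (simp add: sym2_eig_hi_def power2_commute)
  then have "max 0 (max (sym2_eig_hi (- p) (- q) (- r)) (- p - r)) = 0"
    using p r by (simp add: max_def)
  then show ?thesis using assms(1,2) p r by (simp add: pucci_plus_eq mult_nonneg_nonpos)
qed

text \<open>Degenerate ellipticity, from subadditivity applied to A = B + (A - B) with A - B
  negative semidefinite.\<close>

lemma pucci_plus_mono:
  assumes "0 \<le> lam" "lam \<le> Lam"
    and "\<And>e1 e2. 0 \<le> (p' - p) * e1\<^sup>2 + 2 * (q' - q) * e1 * e2 + (r' - r) * e2\<^sup>2"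
  shows "pucci_plus lam Lam p q r \<le> pucci_plus lam Lam p' q' r'"
  using pucci_plus_nonpos[OF assms]
    pucci_plus_subadd[OF assms(2), of p' "- (p' - p)" q' "- (q' - q)" r' "- (r' - r)"]
  by simp

text \<open>A rank-one matrix m v v^T has eigenvalues 0 and m |v|^2, and the weight is positively
  homogeneous. The entries are written as products to match the Hessians of ridge functions
  literally.\<close>

lemma pucci_plus_ridge:
  "pucci_plus lam Lam (m * (\<alpha> * \<alpha>)) (m * (\<alpha> * \<beta>)) (m * (\<beta> * \<beta>))
    = (\<alpha>\<^sup>2 + \<beta>\<^sup>2) * pucci_weight lam Lam m"
proof -
  define n where "n = \<alpha>\<^sup>2 + \<beta>\<^sup>2"
  have n: "0 \<le> n" by (simp add: n_def)
  have tr: "m * (\<alpha> * \<alpha>) + m * (\<beta> * \<beta>) = m * n"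
    by (simp add: n_def power2_eq_square algebra_simps)
  have "(m * (\<alpha> * \<alpha>) - m * (\<beta> * \<beta>))\<^sup>2 + 4 * (m * (\<alpha> * \<beta>))\<^sup>2 = (m * n)\<^sup>2"
    by (simp add: n_def power2_eq_square algebra_simps)
  then have hi: "sym2_eig_hi (m * (\<alpha> * \<alpha>)) (m * (\<alpha> * \<beta>)) (m * (\<beta> * \<beta>)) = (m * n + \<bar>m * n\<bar>) / 2"
    unfolding sym2_eig_hi_def tr by simp
  have "max 0 (max ((m * n + \<bar>m * n\<bar>) / 2) (m * n)) = (if m < 0 then 0 else m * n)"
    using n by (auto simp: max_def abs_if mult_less_0_iff zero_le_mult_iff)
  then show ?thesis
    unfolding pucci_plus_eq hi tr n_def[symmetric] pucci_weight_eq
    by (auto simp: algebra_simps)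
qed

text \<open>For orthogonal vectors of equal squared length \<open>L\<close> the eigenvalues would be
  p L and -n L. A nonzero inner product makes the determinant less negative while the trace is
  unchanged, so the positive eigenvalue drops strictly below p L. This is the source of all
  strictness in the sheared case.\<close>

lemma pucci_plus_two_ridges_less:
  assumes "lam < Lam" "0 < p" "0 < n" "\<alpha>\<^sup>2 + \<beta>\<^sup>2 = L" "\<alpha>'\<^sup>2 + \<beta>'\<^sup>2 = L" "0 < L"
    and "\<alpha> * \<alpha>' + \<beta> * \<beta>' \<noteq> 0"
  shows "pucci_plus lam Lam (p * (\<alpha> * \<alpha>) - n * (\<alpha>' * \<alpha>')) (p * (\<alpha> * \<beta>) - n * (\<alpha>' * \<beta>'))
      (p * (\<beta> * \<beta>) - n * (\<beta>' * \<beta>')) < L * (Lam * p - lam * n)"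
    (is "pucci_plus _ _ ?p ?q ?r < _")
proof -
  have tr: "?p + ?r = (p - n) * L"
    unfolding left_diff_distrib assms(4)[symmetric]
    by (subst (2) assms(5)[symmetric, unfolded assms(4)[symmetric]])
      (simp add: power2_eq_square algebra_simps)
  have "(?p - ?r)\<^sup>2 + 4 * ?q\<^sup>2 = (?p + ?r)\<^sup>2 - 4 * (?p * ?r - ?q\<^sup>2)"
    by (simp add: power2_eq_square algebra_simps)
  also have "?p * ?r - ?q\<^sup>2 = - (p * n) * (\<alpha> * \<beta>' - \<beta> * \<alpha>')\<^sup>2"
    by (simp add: power2_eq_square algebra_simps)
  \<comment> \<open>Lagrange's identity brings in the inner product, the only quantity that
    distinguishes this from the orthogonal case.\<close>
  also have "(\<alpha> * \<beta>' - \<beta> * \<alpha>')\<^sup>2 = (\<alpha>\<^sup>2 + \<beta>\<^sup>2) * (\<alpha>'\<^sup>2 + \<beta>'\<^sup>2) - (\<alpha> * \<alpha>' + \<beta> * \<beta>')\<^sup>2"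
    by (simp add: power2_eq_square algebra_simps)
  also have "(?p + ?r)\<^sup>2 - 4 * (- (p * n) * ((\<alpha>\<^sup>2 + \<beta>\<^sup>2) * (\<alpha>'\<^sup>2 + \<beta>'\<^sup>2) - (\<alpha> * \<alpha>' + \<beta> * \<beta>')\<^sup>2))
      = ((p + n) * L)\<^sup>2 - 4 * p * n * (\<alpha> * \<alpha>' + \<beta> * \<beta>')\<^sup>2"
    unfolding assms(4,5) tr by (simp add: power2_eq_square algebra_simps)
  also have "\<dots> < ((p + n) * L)\<^sup>2" using assms(2,3,7) by (simp add: zero_less_mult_iff)
  finally have "sqrt ((?p - ?r)\<^sup>2 + 4 * ?q\<^sup>2) < (p + n) * L"
    using assms(2,3,6) by (intro real_less_lsqrt) auto
  then have "sym2_eig_hi ?p ?q ?r < p * L"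
    unfolding sym2_eig_hi_def tr by (simp add: algebra_simps)
  then have "max 0 (max (sym2_eig_hi ?p ?q ?r) (?p + ?r)) < p * L"
    unfolding tr using mult_pos_pos[OF assms(2,6)] mult_pos_pos[OF assms(3,6)]
    by (simp add: left_diff_distrib)
  then have "(Lam - lam) * max 0 (max (sym2_eig_hi ?p ?q ?r) (?p + ?r)) < (Lam - lam) * (p * L)"
    using assms(1) by (intro mult_strict_left_mono) auto
  moreover have "pucci_plus lam Lam ?p ?q ?r
      = lam * (?p + ?r) + (Lam - lam) * max 0 (max (sym2_eig_hi ?p ?q ?r) (?p + ?r))"
    by (rule pucci_plus_eq)
  ultimately show ?thesis unfolding tr by (simp add: algebra_simps)
qed

lemma continuous_on_pucci_plus [continuous_intros]:
  assumes "continuous_on S p" "continuous_on S q" "continuous_on S r"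
  shows "continuous_on S (\<lambda>z. pucci_plus lam Lam (p z) (q z) (r z))"
  unfolding pucci_plus_eq sym2_eig_hi_def using assms
  by (intro continuous_intros) auto

section \<open>Second-order touching\<close>

definition partials_on ::
  "(real \<times> real) set \<Rightarrow> (real \<times> real \<Rightarrow> real) \<Rightarrow> (real \<times> real \<Rightarrow> real) \<Rightarrow> (real \<times> real \<Rightarrow> real) \<Rightarrow> bool" where
  "partials_on S f fx fy \<longleftrightarrow> (\<forall>x y. (x, y) \<in> S \<longrightarrow>
     ((\<lambda>t. f (t, y)) has_real_derivative fx (x, y)) (at x) \<and>
     ((\<lambda>t. f (x, t)) has_real_derivative fy (x, y)) (at y))"

text \<open>The partials are required on the whole plane so that \<open>pdx f\<close> and
  \<open>pdy f\<close> equal the witnesses as functions and can be differentiated again. A single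
  \<open>q\<close> plays both mixed derivatives.\<close>

definition has_hess ::
  "(real \<times> real \<Rightarrow> real) \<Rightarrow> (real \<times> real \<Rightarrow> real) \<Rightarrow> (real \<times> real \<Rightarrow> real) \<Rightarrow> (real \<times> real \<Rightarrow> real) \<Rightarrow> bool" where
  "has_hess f p q r \<longleftrightarrow> (\<exists>fx fy. partials_on UNIV f fx fy \<and> partials_on UNIV fx p q \<and>
     partials_on UNIV fy q r \<and> continuous_on UNIV f \<and> continuous_on UNIV fx \<and> continuous_on UNIV fy \<and>
     continuous_on UNIV p \<and> continuous_on UNIV q \<and> continuous_on UNIV r)"

lemma partials_on_eq:
  assumes "partials_on UNIV f fx fy"
  shows "pdx f = fx" "pdy f = fy"
  using assms by (auto simp: partials_on_def pdx_def pdy_def fun_eq_iff intro: DERIV_imp_deriv)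

lemma partials_on_has_partials: "partials_on UNIV f fx fy \<Longrightarrow> has_partials_on f S"
  by (auto simp: partials_on_def has_partials_on_def real_differentiable_def)

lemma has_partials_on_partials: "has_partials_on f S \<Longrightarrow> partials_on S f (pdx f) (pdy f)"
  by (auto simp: partials_on_def has_partials_on_def pdx_def pdy_def DERIV_deriv_iff_real_differentiable)

lemma partials_on_diff:
  "partials_on S f fx fy \<Longrightarrow> partials_on S g gx gy \<Longrightarrow>
    partials_on S (\<lambda>z. f z - g z) (\<lambda>z. fx z - gx z) (\<lambda>z. fy z - gy z)"
  by (auto simp: partials_on_def intro!: DERIV_diff)

lemma partials_on_add:
  "partials_on S f fx fy \<Longrightarrow> partials_on S g gx gy \<Longrightarrow>
    partials_on S (\<lambda>z. f z + g z) (\<lambda>z. fx z + gx z) (\<lambda>z. fy z + gy z)"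
  by (auto simp: partials_on_def intro!: DERIV_add)

lemma partials_on_subset: "partials_on S f fx fy \<Longrightarrow> T \<subseteq> S \<Longrightarrow> partials_on T f fx fy"
  by (auto simp: partials_on_def)

lemma has_hess_C2_on: "has_hess f p q r \<Longrightarrow> C2_on S f"
  unfolding has_hess_def C2_on_def
  by (metis partials_on_eq partials_on_has_partials continuous_on_subset subset_UNIV)

lemma has_hess_pucci:
  "has_hess f p q r \<Longrightarrow> pucci_hess lam Lam f z = pucci_plus lam Lam (p z) (q z) (r z)"
  unfolding has_hess_def pucci_hess_def by (metis partials_on_eq)

lemma has_hess_add:
  assumes "has_hess f p q r" "has_hess f' p' q' r'"
  shows "has_hess (\<lambda>z. f z + f' z) (\<lambda>z. p z + p' z) (\<lambda>z. q z + q' z) (\<lambda>z. r z + r' z)"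
proof -
  from assms obtain fx fy fx' fy' where
    "partials_on UNIV f fx fy" "partials_on UNIV fx p q" "partials_on UNIV fy q r"
    "continuous_on UNIV f" "continuous_on UNIV fx" "continuous_on UNIV fy"
    "continuous_on UNIV p" "continuous_on UNIV q" "continuous_on UNIV r"
    "partials_on UNIV f' fx' fy'" "partials_on UNIV fx' p' q'" "partials_on UNIV fy' q' r'"
    "continuous_on UNIV f'" "continuous_on UNIV fx'" "continuous_on UNIV fy'"
    "continuous_on UNIV p'" "continuous_on UNIV q'" "continuous_on UNIV r'"
    unfolding has_hess_def by blast
  then show ?thesis
    unfolding has_hess_def
    by (intro exI[of _ "\<lambda>z. fx z + fx' z"] exI[of _ "\<lambda>z. fy z + fy' z"])
      (auto intro!: partials_on_add continuous_on_add)
qed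

lemma partials_on_ridge:
  assumes "\<And>t. (F has_real_derivative F' t) (at t)"
  shows "partials_on UNIV (\<lambda>z. \<kappa> * F (\<alpha> * fst z + \<beta> * snd z))
    (\<lambda>z. (\<kappa> * \<alpha>) * F' (\<alpha> * fst z + \<beta> * snd z)) (\<lambda>z. (\<kappa> * \<beta>) * F' (\<alpha> * fst z + \<beta> * snd z))"
  unfolding partials_on_def
  by (auto intro!: derivative_eq_intros DERIV_chain2[OF assms])

text \<open>The eigenfunction, its rotated copies and the bumps are all sums of functions of one
  linear form; for these the Hessian is a multiple of a rank-one matrix.\<close>

lemma has_hess_ridge:
  assumes F: "\<And>t. (F has_real_derivative F' t) (at t)"
    and F': "\<And>t. (F' has_real_derivative F'' t) (at t)"
    and F'': "continuous_on UNIV F''"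
  shows "has_hess (\<lambda>z. \<kappa> * F (\<alpha> * fst z + \<beta> * snd z))
    (\<lambda>z. (\<kappa> * F'' (\<alpha> * fst z + \<beta> * snd z)) * (\<alpha> * \<alpha>))
    (\<lambda>z. (\<kappa> * F'' (\<alpha> * fst z + \<beta> * snd z)) * (\<alpha> * \<beta>))
    (\<lambda>z. (\<kappa> * F'' (\<alpha> * fst z + \<beta> * snd z)) * (\<beta> * \<beta>))"
proof -
  have c: "continuous_on UNIV F" "continuous_on UNIV F'"
    using F F' by (meson DERIV_isCont continuous_at_imp_continuous_on)+
  have r: "partials_on UNIV (\<lambda>z. (\<kappa> * \<gamma>) * F' (\<alpha> * fst z + \<beta> * snd z))
      (\<lambda>z. (\<kappa> * F'' (\<alpha> * fst z + \<beta> * snd z)) * (\<alpha> * \<gamma>))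
      (\<lambda>z. (\<kappa> * F'' (\<alpha> * fst z + \<beta> * snd z)) * (\<gamma> * \<beta>))" for \<gamma>
    using partials_on_ridge[OF F', of "\<kappa> * \<gamma>" \<alpha> \<beta>] by (simp add: mult_ac)
  have lin: "continuous_on UNIV (\<lambda>z. \<alpha> * fst z + \<beta> * snd z)" by (intro continuous_intros)
  show ?thesis
    unfolding has_hess_def
    by (rule exI, rule exI, intro conjI, rule partials_on_ridge[OF F], rule r, rule r)
      (intro continuous_intros continuous_on_compose2[OF c(1) lin]
        continuous_on_compose2[OF c(2) lin] continuous_on_compose2[OF F'' lin]; simp)+
qed

section \<open>Second-order condition at an interior minimum\<close>

lemma DERIV_taylor2:
  fixes f f' f'' :: "real \<Rightarrow> real"
  assumes "\<And>t. \<bar>t - a\<bar> \<le> \<bar>h\<bar> \<Longrightarrow> (f has_real_derivative f' t) (at t)"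
    and "\<And>t. \<bar>t - a\<bar> \<le> \<bar>h\<bar> \<Longrightarrow> (f' has_real_derivative f'' t) (at t)"
  shows "\<exists>\<xi>. \<bar>\<xi> - a\<bar> \<le> \<bar>h\<bar> \<and> f (a + h) = f a + f' a * h + f'' \<xi> / 2 * h\<^sup>2"
proof (cases "h = 0")
  case False
  define df where "df = (\<lambda>m::nat. if m = 0 then f else if m = 1 then f' else f'')"
  have "\<exists>\<xi>. (if a + h < a then a + h < \<xi> \<and> \<xi> < a else a < \<xi> \<and> \<xi> < a + h) \<and>
      f (a + h) = (\<Sum>m<2. df m a / fact m * (a + h - a) ^ m) + df 2 \<xi> / fact 2 * (a + h - a) ^ 2"
  proof (rule Taylor[where a = "a - \<bar>h\<bar>" and b = "a + \<bar>h\<bar>"])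
    show "\<forall>m t. m < 2 \<and> a - \<bar>h\<bar> \<le> t \<and> t \<le> a + \<bar>h\<bar> \<longrightarrow> (df m has_real_derivative df (Suc m) t) (at t)"
      using assms by (auto simp: df_def abs_le_iff less_2_cases_iff)
  qed (use False in \<open>auto simp: df_def\<close>)
  then obtain \<xi> where \<xi>: "if a + h < a then a + h < \<xi> \<and> \<xi> < a else a < \<xi> \<and> \<xi> < a + h"
    "f (a + h) = (\<Sum>m<2. df m a / fact m * (a + h - a) ^ m) + df 2 \<xi> / fact 2 * (a + h - a) ^ 2"
    by blast
  have "\<bar>\<xi> - a\<bar> \<le> \<bar>h\<bar>" using \<xi>(1) by (auto split: if_splits)
  with \<xi>(2) show ?thesis
    by (intro exI[of _ \<xi>]) (auto simp: df_def numeral_2_eq_2)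
qed auto

text \<open>Only the mixed derivative taken first in x and then in y enters: one expands in x along
  a horizontal segment and then corrects in y, so no symmetry of mixed derivatives is needed.\<close>

lemma local_min_hess_nonneg:
  assumes r: "0 < r" and h: "partials_on (ball z0 r) h hx hy"
    and hx: "partials_on (ball z0 r) hx p q" and hy: "partials_on (ball z0 r) hy q' s"
    and cont: "isCont p z0" "isCont q z0" "isCont s z0"
    and min: "\<And>z. z \<in> ball z0 r \<Longrightarrow> h z0 \<le> h z"
  shows "0 \<le> p z0 * e1\<^sup>2 + 2 * q z0 * e1 * e2 + s z0 * e2\<^sup>2"
proof -
  obtain x y where z0: "z0 = (x, y)" by fastforce
  have inball: "(x + u, y + v) \<in> ball z0 r" if "\<bar>u\<bar> + \<bar>v\<bar> < r" for u v
  proof -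
    have "dist z0 (x + u, y + v) \<le> \<bar>u\<bar> + \<bar>v\<bar>"
      unfolding z0 dist_Pair_Pair using sqrt_sum_squares_le_sum_abs[of u v] by (simp add: dist_real_def)
    then show ?thesis using that by simp
  qed
  note D = h[unfolded partials_on_def, rule_format] hx[unfolded partials_on_def, rule_format]
    hy[unfolded partials_on_def, rule_format]
  have crit: "hx (x, y) = 0" "hy (x, y) = 0"
  proof -
    have "\<And>t. \<bar>x - t\<bar> < r \<Longrightarrow> h (x, y) \<le> h (t, y)"
      using min inball[of "_ - x" 0] z0 by (auto simp: abs_minus_commute)
    then show "hx (x, y) = 0"
      using D(1)[of x y, THEN conjunct1] r z0
      by (intro DERIV_local_min[of "\<lambda>t. h (t, y)" _ x r]) auto
    have "\<And>t. \<bar>y - t\<bar> < r \<Longrightarrow> h (x, y) \<le> h (x, t)"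
      using min inball[of 0 "_ - y"] z0 by (auto simp: abs_minus_commute)
    then show "hy (x, y) = 0"
      using D(1)[of x y, THEN conjunct2] r z0
      by (intro DERIV_local_min[of "\<lambda>t. h (x, t)" _ y r]) auto
  qed
  define E where "E = \<bar>e1\<bar> + \<bar>e2\<bar>"
  \<comment> \<open>The second derivatives are evaluated at three different intermediate points;
    continuity at \<open>z0\<close> merges them as \<open>t\<close> tends to 0.\<close>
  have step: "\<exists>P Q S. dist P z0 \<le> t * E \<and> dist Q z0 \<le> t * E \<and> dist S z0 \<le> t * E \<and>
      0 \<le> p P * e1\<^sup>2 + 2 * q Q * e1 * e2 + s S * e2\<^sup>2" if t: "0 < t" "t * E < r" for t
  proof -
    have small: "\<bar>u\<bar> + \<bar>v\<bar> < r" if "\<bar>u\<bar> \<le> \<bar>t * e1\<bar>" "\<bar>v\<bar> \<le> \<bar>t * e2\<bar>" for u v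
      using that t by (simp add: E_def abs_mult algebra_simps)
    have in2: "(a, b) \<in> ball z0 r" if "\<bar>a - x\<bar> \<le> \<bar>t * e1\<bar>" "\<bar>b - y\<bar> \<le> \<bar>t * e2\<bar>" for a b
      using inball[OF small[OF that]] by simp
    have d: "dist (a, b) z0 \<le> t * E" if "\<bar>a - x\<bar> \<le> \<bar>t * e1\<bar>" "\<bar>b - y\<bar> \<le> \<bar>t * e2\<bar>" for a b
    proof -
      have "dist (a, b) z0 \<le> \<bar>a - x\<bar> + \<bar>b - y\<bar>"
        unfolding z0 dist_Pair_Pair using sqrt_sum_squares_le_sum_abs[of "a - x" "b - y"]
        by (simp add: dist_real_def)
      then show ?thesis using that t by (simp add: E_def abs_mult algebra_simps)
    qed
    obtain \<xi> where \<xi>: "\<bar>\<xi> - x\<bar> \<le> \<bar>t * e1\<bar>"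
      "h (x + t * e1, y + t * e2) = h (x, y + t * e2) + hx (x, y + t * e2) * (t * e1)
        + p (\<xi>, y + t * e2) / 2 * (t * e1)\<^sup>2"
      using DERIV_taylor2[of x "t * e1" "\<lambda>u. h (u, y + t * e2)" "\<lambda>u. hx (u, y + t * e2)"
          "\<lambda>u. p (u, y + t * e2)"] in2 D(1,2) by auto
    obtain \<eta> where \<eta>: "\<bar>\<eta> - y\<bar> \<le> \<bar>t * e2\<bar>"
      "h (x, y + t * e2) = h (x, y) + hy (x, y) * (t * e2) + s (x, \<eta>) / 2 * (t * e2)\<^sup>2"
      using DERIV_taylor2[of y "t * e2" "\<lambda>u. h (x, u)" "\<lambda>u. hy (x, u)"
          "\<lambda>u. s (x, u)"] in2 D(1,3) by auto
    obtain \<zeta> where \<zeta>: "\<bar>\<zeta> - y\<bar> \<le> \<bar>t * e2\<bar>"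
      "hx (x, y + t * e2) = hx (x, y) + q (x, \<zeta>) * (t * e2)"
    proof (cases "t * e2 = 0")
      case True then show ?thesis using that[of y] by (simp only: add_0_right mult_zero_right)
    next
      case False
      obtain \<zeta> where "if y < y + t * e2 then y < \<zeta> \<and> \<zeta> < y + t * e2 else y + t * e2 < \<zeta> \<and> \<zeta> < y"
        "hx (x, y + t * e2) - hx (x, y) = q (x, \<zeta>) * (t * e2)"
      proof (cases "0 < t * e2")
        case True
        then show ?thesis using that MVT2[of y "y + t * e2" "\<lambda>u. hx (x, u)" "\<lambda>u. q (x, u)"] in2 D(2)
          by (auto simp: mult.commute)
      next
        case 2: False
        with False have "t * e2 < 0" by linarith
        then show ?thesis using that MVT2[of "y + t * e2" y "\<lambda>u. hx (x, u)" "\<lambda>u. q (x, u)"] in2 D(2)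
          by (fastforce simp: algebra_simps)
      qed
      then show ?thesis using that[of \<zeta>] by (auto split: if_splits)
    qed
    have "h (x, y) \<le> h (x + t * e1, y + t * e2)"
      using min[OF in2[of "x + t * e1" "y + t * e2"]] z0 by simp
    then have "0 \<le> t\<^sup>2 / 2 * (p (\<xi>, y + t * e2) * e1\<^sup>2 + 2 * q (x, \<zeta>) * e1 * e2 + s (x, \<eta>) * e2\<^sup>2)"
      unfolding \<xi>(2) \<eta>(2) \<zeta>(2) crit by (simp add: power2_eq_square algebra_simps)
    then have "0 \<le> p (\<xi>, y + t * e2) * e1\<^sup>2 + 2 * q (x, \<zeta>) * e1 * e2 + s (x, \<eta>) * e2\<^sup>2"
      using t by (simp add: zero_le_mult_iff)
    moreover have "dist (\<xi>, y + t * e2) z0 \<le> t * E" using \<xi> by (intro d) auto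
    moreover have "dist (x, \<zeta>) z0 \<le> t * E" using \<zeta> by (intro d) auto
    moreover have "dist (x, \<eta>) z0 \<le> t * E" using \<eta> by (intro d) auto
    ultimately show ?thesis by blast
  qed
  \<comment> \<open>The denominator \<open>E + 1\<close> covers the case \<open>E = 0\<close> and,
    with \<open>n + 2\<close>, keeps every step inside the ball while the steps tend to 0.\<close>
  define t where "t = (\<lambda>n::nat. r / (E + 1) / real (n + 2))"
  have E: "0 \<le> E" by (simp add: E_def)
  have tE: "t n * E < r" for n
  proof -
    have "(E + 1) * 1 \<le> (E + 1) * real (n + 2)" using E by (intro mult_left_mono) auto
    then have "r * E < r * ((E + 1) * real (n + 2))" using r by (intro mult_strict_left_mono) auto
    moreover have "0 < (E + 1) * real (n + 2)" using E by simp
    ultimately have "r * E / ((E + 1) * real (n + 2)) < r" by (simp only: pos_divide_less_eq)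
    then show ?thesis by (simp add: t_def)
  qed
  have "\<forall>n. \<exists>P Q S. dist P z0 \<le> t n * E \<and> dist Q z0 \<le> t n * E \<and> dist S z0 \<le> t n * E \<and>
      0 \<le> p P * e1\<^sup>2 + 2 * q Q * e1 * e2 + s S * e2\<^sup>2"
    using r E tE by (intro allI step) (auto simp: t_def)
  then obtain P Q S where PQS: "\<And>n. dist (P n) z0 \<le> t n * E" "\<And>n. dist (Q n) z0 \<le> t n * E"
    "\<And>n. dist (S n) z0 \<le> t n * E"
    "\<And>n. 0 \<le> p (P n) * e1\<^sup>2 + 2 * q (Q n) * e1 * e2 + s (S n) * e2\<^sup>2"
    by metis
  have "(\<lambda>n. inverse (real (n + 2))) \<longlonglongrightarrow> 0"
    using LIMSEQ_ignore_initial_segment[OF lim_inverse_n, of 2] by simp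
  then have "(\<lambda>n. (r / (E + 1) * E) * inverse (real (n + 2))) \<longlonglongrightarrow> (r / (E + 1) * E) * 0"
    by (intro tendsto_intros)
  then have t0: "(\<lambda>n. t n * E) \<longlonglongrightarrow> 0" by (simp add: t_def field_simps)
  have lim: "X \<longlonglongrightarrow> z0" if "\<And>n. dist (X n) z0 \<le> t n * E" for X
    by (rule tendstoI, rule eventually_mono[OF order_tendstoD(2)[OF t0]])
      (use that in \<open>auto intro: le_less_trans\<close>)
  have "(\<lambda>n. p (P n) * e1\<^sup>2 + 2 * q (Q n) * e1 * e2 + s (S n) * e2\<^sup>2)
      \<longlonglongrightarrow> p z0 * e1\<^sup>2 + 2 * q z0 * e1 * e2 + s z0 * e2\<^sup>2"
    using PQS(1-3)[THEN lim] cont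
    by (intro tendsto_intros isCont_tendsto_compose[of z0 p] isCont_tendsto_compose[of z0 q]
        isCont_tendsto_compose[of z0 s])
  then show ?thesis using PQS(4) by (intro LIMSEQ_le_const) auto
qed

text \<open>When \<open>psi\<close> touches from below, \<open>V - psi\<close> has a local minimum,
  so the Hessian of \<open>V\<close> dominates that of \<open>psi\<close> and ellipticity transfers
  the inequality. The smooth \<open>V\<close> lives on the plane, while \<open>u\<close> agrees with
  it only on the domain.\<close>

lemma visc_supersol_classical:
  assumes "0 \<le> lam" "lam \<le> Lam" "open \<Omega>" and V: "has_hess V p q r"
    and eq: "\<And>z. z \<in> \<Omega> \<Longrightarrow> u z = V z"
    and le: "\<And>z. z \<in> \<Omega> \<Longrightarrow> pucci_plus lam Lam (p z) (q z) (r z) + mu * V z \<le> 0"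
  shows "visc_supersol lam Lam mu \<Omega> u"
  unfolding visc_supersol_def
proof (intro ballI allI impI)
  fix z0 psi \<rho>
  assume z0: "z0 \<in> \<Omega>" and \<rho>: "(0::real) < \<rho>" and C2: "C2_on (ball z0 \<rho>) psi"
    and min: "\<forall>z\<in>\<Omega> \<inter> ball z0 \<rho>. u z - psi z \<ge> u z0 - psi z0"
  obtain \<delta> where \<delta>: "0 < \<delta>" "\<delta> \<le> \<rho>" "ball z0 \<delta> \<subseteq> \<Omega>"
  proof -
    obtain e where "0 < e" "ball z0 e \<subseteq> \<Omega>" using assms(3) z0 openE by blast
    then show ?thesis using \<rho> by (intro that[of "min e \<rho>"]) auto
  qed
  have sub: "ball z0 \<delta> \<subseteq> ball z0 \<rho>" using \<delta> by (simp add: subset_ball)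
  from V obtain Vx Vy where V':
    "partials_on UNIV V Vx Vy" "partials_on UNIV Vx p q" "partials_on UNIV Vy q r"
    "continuous_on UNIV p" "continuous_on UNIV q" "continuous_on UNIV r"
    unfolding has_hess_def by blast
  have psi: "partials_on (ball z0 \<delta>) psi (pdx psi) (pdy psi)"
    "partials_on (ball z0 \<delta>) (pdx psi) (pdx (pdx psi)) (pdy (pdx psi))"
    "partials_on (ball z0 \<delta>) (pdy psi) (pdx (pdy psi)) (pdy (pdy psi))"
    using C2 partials_on_subset[OF has_partials_on_partials sub] unfolding C2_on_def by auto
  have cp: "isCont (pdx (pdx psi)) z0" "isCont (pdy (pdx psi)) z0" "isCont (pdy (pdy psi)) z0"
    using C2 \<rho> unfolding C2_on_def by (auto simp: continuous_on_eq_continuous_at)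
  have cV: "isCont p z0" "isCont q z0" "isCont r z0"
    using V'(4-6) by (simp_all add: continuous_on_eq_continuous_at del: split_paired_All)
  have "0 \<le> (p z0 - pdx (pdx psi) z0) * e1\<^sup>2 + 2 * (q z0 - pdy (pdx psi) z0) * e1 * e2
      + (r z0 - pdy (pdy psi) z0) * e2\<^sup>2" for e1 e2
    by (rule local_min_hess_nonneg[OF \<delta>(1), where h = "\<lambda>z. V z - psi z"
          and hx = "\<lambda>z. Vx z - pdx psi z" and hy = "\<lambda>z. Vy z - pdy psi z"
          and p = "\<lambda>z. p z - pdx (pdx psi) z" and q = "\<lambda>z. q z - pdy (pdx psi) z"
          and q' = "\<lambda>z. q z - pdx (pdy psi) z" and s = "\<lambda>z. r z - pdy (pdy psi) z"])
      (use psi V'(1-3)[THEN partials_on_subset] cp cV min eq \<delta> sub z0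
        in \<open>auto intro!: partials_on_diff continuous_intros\<close>)
  then have "pucci_hess lam Lam psi z0 \<le> pucci_plus lam Lam (p z0) (q z0) (r z0)"
    unfolding pucci_hess_def by (intro pucci_plus_mono assms)
  then show "pucci_hess lam Lam psi z0 + mu * u z0 \<le> 0"
    using le[OF z0] eq[OF z0] by simp
qed

section \<open>The one-dimensional profile\<close>

text \<open>The profile \<open>f\<close> of the overview, with \<open>s\<close> the square root of
  \<Lambda>/\<lambda>. Beyond its zero the cosine is continued by a solution of f'' = -f/s^2 with
  the same slope; as f vanishes at the junction, so does f'' from both sides, which makes the
  profile C^2.\<close>

definition gcos :: "real \<Rightarrow> real \<Rightarrow> real" where
  "gcos s t = (if \<bar>t\<bar> \<le> pi / 2 then cos t else - s * sin ((\<bar>t\<bar> - pi / 2) / s))"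

definition gcos1 :: "real \<Rightarrow> real \<Rightarrow> real" where
  "gcos1 s t = (if \<bar>t\<bar> \<le> pi / 2 then - sin t else - sgn t * cos ((\<bar>t\<bar> - pi / 2) / s))"

definition gcos2 :: "real \<Rightarrow> real \<Rightarrow> real" where
  "gcos2 s t = (if \<bar>t\<bar> \<le> pi / 2 then - cos t else sin ((\<bar>t\<bar> - pi / 2) / s) / s)"

lemma DERIV_glue:
  fixes F G :: "real \<Rightarrow> real"
  assumes F: "\<And>t. t \<le> a \<Longrightarrow> (F has_real_derivative F' t) (at t)"
    and G: "\<And>t. a \<le> t \<Longrightarrow> (G has_real_derivative G' t) (at t)"
    and eq: "F a = G a" "F' a = G' a"
  shows "((\<lambda>t. if t \<le> a then F t else G t) has_real_derivative (if t \<le> a then F' t else G' t)) (at t)"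
proof -
  have "((\<lambda>t. if t \<in> {..a} then F t else G t) has_vector_derivative
      (if t \<in> {..a} then F' t else G' t)) (at t within UNIV)"
    by (rule has_vector_derivative_If_within_closures[of _ "{..a}" "{a<..}"])
      (use eq F G in \<open>auto simp: has_real_derivative_iff_has_vector_derivative[symmetric]
        intro: has_field_derivative_at_within\<close>)
  then show ?thesis by (simp add: has_real_derivative_iff_has_vector_derivative)
qed

lemma
  assumes s: "0 < s"
  shows DERIV_gcos: "(gcos s has_real_derivative gcos1 s t) (at t)"
    and DERIV_gcos1: "(gcos1 s has_real_derivative gcos2 s t) (at t)"
    and continuous_on_gcos2: "continuous_on UNIV (gcos2 s)"
proof -
  \<comment> \<open>The even definition is rewritten in three pieces cut at -pi/2 and pi/2, so that
    gluing applies twice. The point -pi/2 moves from the middle piece to the left one and is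
    therefore compared separately.\<close>
  have split: "f = f'"
    if "\<And>t. t < 0 \<Longrightarrow> \<not> - t \<le> pi / 2 \<Longrightarrow> t \<le> - pi / 2 \<Longrightarrow> f t = f' t"
      "f (- (pi / 2)) = f' (- (pi / 2))"
      "\<And>t. \<bar>t\<bar> \<le> pi / 2 \<Longrightarrow> - (pi / 2) < t \<Longrightarrow> f t = f' t"
      "\<And>t. 0 < t \<Longrightarrow> \<not> t \<le> pi / 2 \<Longrightarrow> \<not> t \<le> - pi / 2 \<Longrightarrow> f t = f' t"
    for f f' :: "real \<Rightarrow> real"
  proof
    fix t :: real
    consider "t < - (pi / 2)" | "t = - (pi / 2)" | "- (pi / 2) < t" "t \<le> pi / 2" | "pi / 2 < t"
      by linarith
    then show "f t = f' t" using that pi_gt_zero by cases auto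
  qed
  have g: "gcos s = (\<lambda>t. if t \<le> - pi / 2 then - s * sin ((- t - pi / 2) / s)
      else if t \<le> pi / 2 then cos t else - s * sin ((t - pi / 2) / s))"
    by (rule split) (auto simp: gcos_def abs_of_neg abs_of_pos)
  have g1: "gcos1 s = (\<lambda>t. if t \<le> - pi / 2 then cos ((- t - pi / 2) / s)
      else if t \<le> pi / 2 then - sin t else - cos ((t - pi / 2) / s))"
    by (rule split) (auto simp: gcos1_def abs_of_neg abs_of_pos)
  have g2: "gcos2 s = (\<lambda>t. if t \<le> - pi / 2 then sin ((- t - pi / 2) / s) / s
      else if t \<le> pi / 2 then - cos t else sin ((t - pi / 2) / s) / s)"
    by (rule split) (auto simp: gcos2_def abs_of_neg abs_of_pos)
  \<comment> \<open>Clamping makes each summand vanish on the other's region, so continuity needs no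
    gluing.\<close>
  have g3: "gcos2 s = (\<lambda>t. sin (max 0 (\<bar>t\<bar> - pi / 2) / s) / s - cos (min \<bar>t\<bar> (pi / 2)))"
  proof
    fix t
    show "gcos2 s t = sin (max 0 (\<bar>t\<bar> - pi / 2) / s) / s - cos (min \<bar>t\<bar> (pi / 2))"
      by (cases "\<bar>t\<bar> \<le> pi / 2") (simp_all add: gcos2_def max_absorb1 max_absorb2 min_absorb1 min_absorb2)
  qed
  have i: "((\<lambda>t. if t \<le> pi / 2 then cos t else - s * sin ((t - pi / 2) / s)) has_real_derivative
      (if t \<le> pi / 2 then - sin t else - cos ((t - pi / 2) / s))) (at t)" for t
    using s by (intro DERIV_glue) (auto intro!: derivative_eq_intros)
  have i1: "((\<lambda>t. if t \<le> pi / 2 then - sin t else - cos ((t - pi / 2) / s)) has_real_derivative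
      (if t \<le> pi / 2 then - cos t else sin ((t - pi / 2) / s) / s)) (at t)" for t
    using s by (intro DERIV_glue) (auto intro!: derivative_eq_intros)
  show "(gcos s has_real_derivative gcos1 s t) (at t)"
    unfolding g g1 using s by (intro DERIV_glue i) (auto intro!: derivative_eq_intros)
  show "(gcos1 s has_real_derivative gcos2 s t) (at t)"
    unfolding g1 g2 using s by (intro DERIV_glue i1) (auto intro!: derivative_eq_intros)
  show "continuous_on UNIV (gcos2 s)"
    unfolding g3 using s by (intro continuous_intros) auto
qed

section \<open>Monotonicity, sign and Pucci weight of the profile\<close>

lemma continuous_on_gcos: "0 < s \<Longrightarrow> continuous_on UNIV (gcos s)"
  by (meson DERIV_gcos DERIV_isCont continuous_at_imp_continuous_on)

lemma gcos_minus [simp]: "gcos s (- t) = gcos s t"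
  by (simp add: gcos_def)

lemma gcos_abs: "gcos s \<bar>t\<bar> = gcos s t"
  by (simp add: abs_if)

lemma abs_gcos1_le: "\<bar>gcos1 s t\<bar> \<le> 1"
  by (auto simp: gcos1_def abs_mult abs_sgn_eq)

lemma gcos_lipschitz:
  assumes "0 < s"
  shows "\<bar>gcos s t - gcos s u\<bar> \<le> \<bar>t - u\<bar>"
  using field_differentiable_bound[of UNIV "gcos s" "gcos1 s" 1 t u] DERIV_gcos[OF assms] abs_gcos1_le
  by auto

text \<open>The range ends where the outer sine reaches its maximum, that is, where the derivative
  first vanishes again.\<close>

lemma gcos_less:
  assumes s: "0 < s" and "\<bar>t\<bar> < \<bar>u\<bar>" "\<bar>u\<bar> \<le> pi / 2 + s * (pi / 2)"
  shows "gcos s u < gcos s t"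
proof -
  have "gcos s \<bar>u\<bar> < gcos s \<bar>t\<bar>"
  proof (rule DERIV_neg_imp_decreasing_open[OF assms(2)])
    fix x assume x: "\<bar>t\<bar> < x" "x < \<bar>u\<bar>"
    have "gcos1 s x < 0"
    proof (cases "x \<le> pi / 2")
      case True
      then show ?thesis using x sin_gt_zero[of x] pi_gt_zero by (auto simp: gcos1_def)
    next
      case False
      have "(x - pi / 2) / s < pi / 2" using x assms by (simp add: field_simps)
      moreover have "0 < (x - pi / 2) / s" using False s by simp
      ultimately have "0 < cos ((x - pi / 2) / s)" using pi_gt_zero by (intro cos_gt_zero_pi) linarith+
      moreover have "0 < x" using x by linarith
      ultimately show ?thesis using False by (simp add: gcos1_def)
    qed
    then show "\<exists>y. (gcos s has_real_derivative y) (at x) \<and> y < 0" using DERIV_gcos[OF s] by blast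
  qed (use continuous_on_gcos[OF s] in \<open>auto intro: continuous_on_subset\<close>)
  then show ?thesis by (simp add: gcos_abs)
qed

lemma gcos_mono:
  "0 < s \<Longrightarrow> \<bar>t\<bar> \<le> \<bar>u\<bar> \<Longrightarrow> \<bar>u\<bar> \<le> pi / 2 + s * (pi / 2) \<Longrightarrow> gcos s u \<le> gcos s t"
  using gcos_less[of s t u] gcos_abs[of s t] gcos_abs[of s u] by (cases "\<bar>t\<bar> = \<bar>u\<bar>") auto

lemma gcos_le_1: "1 \<le> s \<Longrightarrow> \<bar>t\<bar> \<le> pi / 2 + s * (pi / 2) \<Longrightarrow> gcos s t \<le> 1"
  using gcos_mono[of s 0 t] by (simp add: gcos_def)

lemma gcos_end:
  assumes "1 \<le> s" "\<bar>t\<bar> = pi / 2 + s * (pi / 2)"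
  shows "gcos s t = - s"
proof -
  have "\<not> \<bar>t\<bar> \<le> pi / 2" using assms by (simp add: not_le)
  then show ?thesis using assms by (simp add: gcos_def)
qed

lemma gcos_pos_iff:
  assumes "1 \<le> s" "\<bar>t\<bar> \<le> pi / 2 + s * (pi / 2)"
  shows "0 < gcos s t \<longleftrightarrow> \<bar>t\<bar> < pi / 2"
proof -
  have 0: "gcos s (pi / 2) = 0" by (simp add: gcos_def)
  have "pi / 2 \<le> pi / 2 + s * (pi / 2)" using assms by simp
  then show ?thesis
    using gcos_less[of s t "pi / 2"] gcos_mono[of s "pi / 2" t] 0 assms by force
qed

lemma gcos_ge:
  assumes "1 \<le> s" "pi / 2 \<le> \<bar>t\<bar>"
  shows "- (\<bar>t\<bar> - pi / 2) \<le> gcos s t"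
proof -
  have "gcos s \<bar>t\<bar> - gcos s (pi / 2) \<ge> - \<bar>\<bar>t\<bar> - pi / 2\<bar>"
    using gcos_lipschitz[of s "\<bar>t\<bar>" "pi / 2"] assms by linarith
  then show ?thesis using assms by (simp add: gcos_abs) (simp add: gcos_def)
qed

lemma gcos_ge_sin:
  assumes "0 \<le> \<delta>" "\<bar>t\<bar> \<le> pi / 2 - \<delta>"
  shows "sin \<delta> \<le> gcos s t"
proof -
  have "cos (pi / 2 - \<delta>) \<le> cos \<bar>t\<bar>" using assms by (intro cos_monotone_0_pi_le) auto
  then show ?thesis using assms by (simp add: gcos_def cos_diff)
qed

lemma gcos2_inner: "\<bar>t\<bar> \<le> pi / 2 \<Longrightarrow> gcos2 s t = - gcos s t"
  by (simp add: gcos_def gcos2_def)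

lemma gcos2_outer: "0 < s \<Longrightarrow> pi / 2 \<le> \<bar>t\<bar> \<Longrightarrow> gcos2 s t = - gcos s t / s\<^sup>2"
proof (cases "\<bar>t\<bar> = pi / 2")
  case True
  then have "cos t = 0" by (metis cos_abs_real cos_pi_half)
  then show ?thesis using True by (simp add: gcos_def gcos2_def)
next
  case False
  then show "0 < s \<Longrightarrow> pi / 2 \<le> \<bar>t\<bar> \<Longrightarrow> ?thesis"
    by (simp add: gcos_def gcos2_def power2_eq_square)
qed

text \<open>Inside, f'' = -f is nonpositive and gets weight \<lambda>; outside, f'' = -f/s^2 is
  nonnegative and gets weight \<Lambda> = s^2 \<lambda>. Both give -\<lambda> f. The range extends
  beyond the minimum of the profile, as far as the sine keeps its sign, which leaves room for
  rotated points that overshoot the domain.\<close>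

lemma gcos_weight:
  assumes "0 < s" "\<bar>t\<bar> \<le> pi / 2 + s * pi" "0 < lam" "Lam = s\<^sup>2 * lam" "0 \<le> \<kappa>"
  shows "pucci_weight lam Lam (\<kappa> * gcos2 s t) = - lam * (\<kappa> * gcos s t)"
proof (cases "\<bar>t\<bar> \<le> pi / 2")
  case True
  then have "0 \<le> \<kappa> * gcos s t" using assms by (auto simp: gcos_def intro!: cos_ge_zero mult_nonneg_nonneg)
  then show ?thesis using True by (simp add: pucci_weight_def gcos2_inner)
next
  case False
  then have "0 \<le> sin ((\<bar>t\<bar> - pi / 2) / s)" using assms by (intro sin_ge_zero) (auto simp: field_simps)
  then have "0 \<le> \<kappa> * gcos2 s t" using False assms by (auto simp: gcos2_def)
  moreover have "Lam * (\<kappa> * gcos2 s t) = - lam * (\<kappa> * gcos s t)"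
    using gcos2_outer[of s t] False assms by (simp add: field_simps)
  ultimately show ?thesis by (auto simp: pucci_weight_def)
qed

lemma abs_gcos2_le:
  assumes "1 \<le> s" "0 \<le> t"
  shows "\<bar>gcos2 s t\<bar> \<le> \<bar>t - pi / 2\<bar>"
proof (cases "t \<le> pi / 2")
  case True
  then have "\<bar>gcos2 s t\<bar> = \<bar>sin (t - pi / 2)\<bar>" using assms by (simp add: gcos2_def sin_diff)
  then show ?thesis using abs_sin_x_le_abs_x by metis
next
  case False
  then have "\<bar>gcos2 s t\<bar> = \<bar>sin ((t - pi / 2) / s)\<bar> / s" using assms by (simp add: gcos2_def)
  also have "\<dots> \<le> \<bar>(t - pi / 2) / s\<bar> / s"
    using assms by (intro divide_right_mono abs_sin_x_le_abs_x) auto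
  also have "\<dots> \<le> \<bar>t - pi / 2\<bar>"
  proof -
    have "1 \<le> s * s" using assms by (simp add: mult_ge1_I)
    from mult_left_mono[OF this, of "\<bar>t - pi / 2\<bar>"] show ?thesis using assms by (simp add: field_simps)
  qed
  finally show ?thesis .
qed

lemma gcos1_le:
  assumes "1 \<le> s" "\<bar>t - pi / 2\<bar> \<le> 1"
  shows "gcos1 s t \<le> - 1 / 2"
proof -
  have half: "1 / 2 \<le> cos u" if "\<bar>u\<bar> \<le> 1" for u :: real
  proof -
    \<comment> \<open>The radius 1 is below pi/3, whose cosine is 1/2.\<close>
    have "cos (pi / 3) \<le> cos \<bar>u\<bar>" using that pi_gt3 by (intro cos_monotone_0_pi_le) auto
    then show ?thesis by (simp add: cos_60)
  qed
  have t: "0 < t" using assms pi_gt3 by linarith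
  show ?thesis
  proof (cases "t \<le> pi / 2")
    case True
    then show ?thesis using half[of "t - pi / 2"] assms t by (simp add: gcos1_def cos_diff)
  next
    case False
    have "\<bar>(t - pi / 2) / s\<bar> \<le> 1" using assms False by (simp add: field_simps)
    then show ?thesis using False t half[of "(t - pi / 2) / s"] by (simp add: gcos1_def)
  qed
qed

text \<open>Shrinking the argument by the factor \<open>1 - \<tau>\<^sup>2/4\<close> raises the profile near its zero by an amount
  of order \<open>\<tau>\<^sup>2\<close>, while averaging over \<open>\<plusminus>\<tau>h\<close> costs only \<open>\<tau>\<^sup>2 h\<^sup>2\<close> times the second derivative,
  which vanishes at the zero.\<close>

lemma gcos_corner:
  assumes s: "1 \<le> s" and H: "1 \<le> H" "\<bar>h\<bar> \<le> H" and \<delta>: "0 < \<delta>" "64 * H\<^sup>2 * \<delta> \<le> 1"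
    and \<tau>: "0 < \<tau>" "4 * H * \<tau> \<le> \<delta>" and t: "\<bar>\<bar>t\<bar> - pi / 2\<bar> \<le> \<delta>"
    and \<sigma>: "\<sigma> = 1 - \<tau>\<^sup>2 / 4"
  shows "2 * gcos s t \<le> gcos s (\<sigma> * (t + \<tau> * h)) + gcos s (\<sigma> * (t - \<tau> * h))"
proof -
  have s0: "0 < s" using s by simp
  have H2: "1 \<le> H\<^sup>2" using H by (simp add: one_le_power)
  have \<delta>1: "\<delta> \<le> 1 / 64" using mult_right_mono[OF H2, of \<delta>] \<delta> by linarith
  have "4 * \<tau> \<le> 4 * H * \<tau>" using H \<tau> by simp
  then have \<tau>1: "4 * \<tau> \<le> \<delta>" using \<tau> by linarith
  have \<tau>sq: "\<tau>\<^sup>2 \<le> \<tau>" using \<tau>1 \<delta>1 \<tau> by (simp add: power2_eq_square mult_le_cancel_right1)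
  have \<sigma>b: "0 < \<sigma>" "\<sigma> \<le> 1" using \<sigma> \<tau>sq \<tau>1 \<delta>1 by auto
  \<comment> \<open>By evenness only the shrunk modulus \<open>a\<close> and the size
    \<open>e\<close> of the shift matter; the two sample points are a + e and a - e up to
    sign.\<close>
  define a where "a = \<sigma> * \<bar>t\<bar>"
  define e where "e = \<sigma> * \<tau> * \<bar>h\<bar>"
  have e0: "0 \<le> e" using \<sigma>b \<tau> by (simp add: e_def)
  have e1: "e \<le> \<tau> * H"
    using mult_mono[of "\<sigma> * \<tau>" \<tau> "\<bar>h\<bar>" H] \<sigma>b \<tau> H by (simp add: e_def mult_le_cancel_right1)
  have e2: "4 * e \<le> \<delta>" using e1 \<tau> by (simp add: mult_ac)
  have T: "1 \<le> \<bar>t\<bar>" "\<bar>t\<bar> \<le> 2" using t \<delta>1 pi_gt3 pi_less_4 pi_approx by auto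
  have ta: "\<bar>t\<bar> - a = \<tau>\<^sup>2 / 4 * \<bar>t\<bar>" by (simp add: a_def \<sigma> algebra_simps)
  have ta1: "\<tau>\<^sup>2 / 4 \<le> \<bar>t\<bar> - a" unfolding ta using T mult_left_mono[of 1 "\<bar>t\<bar>" "\<tau>\<^sup>2 / 4"] by simp
  have ta2: "\<bar>t\<bar> - a \<le> \<tau> / 2"
    unfolding ta using T mult_mono[of "\<tau>\<^sup>2 / 4" "\<tau> / 4" "\<bar>t\<bar>" 2] \<tau>sq \<tau> by simp
  have near: "\<bar>x - pi / 2\<bar> \<le> 2 * \<delta>" "0 \<le> x" if "a - e \<le> x" "x \<le> \<bar>t\<bar> + e" for x
  proof -
    show 1: "\<bar>x - pi / 2\<bar> \<le> 2 * \<delta>" using that ta2 \<tau>1 \<tau>(1) e2 t \<delta>(1) by linarith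
    show "0 \<le> x" using 1 \<delta>1 pi_gt3 by linarith
  qed
  have "0 < \<tau>\<^sup>2" using \<tau> by simp
  then have "a < \<bar>t\<bar>" using ta1 by linarith
  then obtain \<zeta> where \<zeta>: "a < \<zeta>" "\<zeta> < \<bar>t\<bar>" "gcos s \<bar>t\<bar> - gcos s a = (\<bar>t\<bar> - a) * gcos1 s \<zeta>"
    using MVT2[of a "\<bar>t\<bar>" "gcos s" "gcos1 s"] DERIV_gcos[OF s0] by blast
  \<comment> \<open>Shrinking moves the point inwards by at least \<tau>^2/4, since |t| \<ge> 1, and
    the slope there is at most -1/2: a gain of \<tau>^2/8.\<close>
  have "gcos1 s \<zeta> \<le> - 1 / 2" using near(1)[of \<zeta>] \<zeta> e0 \<delta>1 by (intro gcos1_le[OF s]) auto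
  then have le: "(\<bar>t\<bar> - a) * gcos1 s \<zeta> \<le> (\<bar>t\<bar> - a) * (- 1 / 2)"
    using \<open>a < \<bar>t\<bar>\<close> by (intro mult_left_mono) auto
  then have shrink: "gcos s \<bar>t\<bar> + \<tau>\<^sup>2 / 8 \<le> gcos s a"
  proof -
    have "A + q / 8 \<le> B" if "P \<le> T * (- 1 / 2)" "A - B = P" "q / 4 \<le> T" for A B P T q :: real
      using that by linarith
    from this[OF le \<zeta>(3) ta1] show ?thesis .
  qed
  \<comment> \<open>For b = e and b = -e the linear terms cancel in the sum; only the quadratic loss
    remains.\<close>
  have taylor: "gcos s a + gcos1 s a * b - \<delta> * e\<^sup>2 \<le> gcos s (a + b)" if b: "\<bar>b\<bar> = e" for b
  proof -
    obtain \<xi> where \<xi>: "\<bar>\<xi> - a\<bar> \<le> \<bar>b\<bar>" "gcos s (a + b) = gcos s a + gcos1 s a * b + gcos2 s \<xi> / 2 * b\<^sup>2"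
      using DERIV_taylor2[of a b "gcos s" "gcos1 s" "gcos2 s"] DERIV_gcos[OF s0] DERIV_gcos1[OF s0] by blast
    have "a - e \<le> \<xi>" "\<xi> \<le> \<bar>t\<bar> + e" using \<xi>(1) b \<open>a < \<bar>t\<bar>\<close> by linarith+
    from near[OF this] have "\<bar>gcos2 s \<xi>\<bar> \<le> 2 * \<delta>" using abs_gcos2_le[OF s, of \<xi>] by linarith
    then have "- \<delta> * b\<^sup>2 \<le> gcos2 s \<xi> / 2 * b\<^sup>2" by (intro mult_right_mono) auto
    moreover have "b\<^sup>2 = e\<^sup>2" using b by (metis power2_abs)
    ultimately show ?thesis using \<xi>(2) by simp
  qed
  have "e\<^sup>2 \<le> (\<tau> * H)\<^sup>2" using e0 e1 by (intro power_mono)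
  then have "\<delta> * e\<^sup>2 \<le> \<delta> * (\<tau> * H)\<^sup>2" using \<delta> by (intro mult_left_mono) auto
  \<comment> \<open>The constant 64 keeps each quadratic loss well below the gain
    \<tau>^2/8.\<close>
  also have "\<dots> \<le> \<tau>\<^sup>2 / 64"
    using mult_right_mono[OF \<delta>(2), of "\<tau>\<^sup>2"] by (simp add: power_mult_distrib mult_ac)
  finally have main: "2 * gcos s t \<le> gcos s (a + e) + gcos s (a - e)"
    using taylor[of e, simplified] taylor[of "- e", simplified] shrink[unfolded gcos_abs] e0
      zero_le_power2[of \<tau>] by linarith
  have "\<sigma> * (t + \<tau> * h) = (if 0 \<le> t then a else - a) + (if 0 \<le> h then e else - e)"
    "\<sigma> * (t - \<tau> * h) = (if 0 \<le> t then a else - a) - (if 0 \<le> h then e else - e)"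
    by (simp_all add: a_def e_def algebra_simps)
  then show ?thesis
    using main gcos_minus[of s "a + e"] gcos_minus[of s "a - e"]
    by (cases "0 \<le> t"; cases "0 \<le> h") simp_all
qed

section \<open>The domains\<close>

definition Usum :: "real \<Rightarrow> real \<Rightarrow> real \<times> real \<Rightarrow> real" where
  "Usum s g z = g * gcos s (fst z) + gcos s (snd z)"

text \<open>The place where the profile attains its minimum -s. Beyond it the outer sine turns back,
  so domains described by the sign of a sum of profiles have to be cut off here.\<close>

definition Lstar :: "real \<Rightarrow> real" where
  "Lstar s = pi / 2 + s * (pi / 2)"

lemma gcos_outer: "pi / 2 \<le> \<bar>t\<bar> \<Longrightarrow> gcos s t = - s * sin ((\<bar>t\<bar> - pi / 2) / s)"
proof (cases "\<bar>t\<bar> = pi / 2")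
  case True
  then have "cos t = 0" by (metis cos_abs_real cos_pi_half)
  then show ?thesis unfolding gcos_def True by simp
qed (simp add: gcos_def)

text \<open>The graph description is inverted into a positivity set, on which continuity and
  star-shapedness are immediate. The bounds on \<open>g\<close> say g/s \<le> 1 and 1/(g s) \<le> 1,
  so every arcsine has an admissible argument, and the cut-off at \<open>Lstar\<close> confines the
  angles to where sine is injective.\<close>

lemma Omega_wg_eq:
  assumes s: "1 \<le> s" "s = sqrt w" and g: "1 / s \<le> g" "g \<le> s"
  shows "Omega_wg w g = {z. \<bar>fst z\<bar> < Lstar s \<and> \<bar>snd z\<bar> < Lstar s \<and> 0 < Usum s g z}"
proof -
  have s0: "0 < s" using s by simp
  have g0: "0 < g" using g s0 less_le_trans[of 0 "1 / s" g] by simp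
  have gs: "1 \<le> g * s" using g s0 by (simp add: field_simps)
  have gs1: "g / s \<le> 1" using g s0 by simp
  have L: "pi / 2 < Lstar s" using s0 by (simp add: Lstar_def)
  have "\<bar>x\<bar> \<le> Lbound w g \<and> \<bar>y\<bar> < phiwg w g x \<longleftrightarrow>
      \<bar>x\<bar> < Lstar s \<and> \<bar>y\<bar> < Lstar s \<and> 0 < g * gcos s x + gcos s y" (is "?l \<longleftrightarrow> ?r") for x y
  proof (cases "\<bar>x\<bar> \<le> pi / 2")
    case True
    have c0: "0 \<le> cos x" using True by (intro cos_ge_zero) auto
    have gx: "gcos s x = cos x" using True by (simp add: gcos_def)
    have m0: "0 \<le> g / s * cos x" using c0 g0 s0 by simp
    have m1: "g / s * cos x \<le> 1" using mult_mono[OF gs1 cos_le_one[of x]] c0 by simp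
    have as: "0 \<le> arcsin (g / s * cos x)" "arcsin (g / s * cos x) \<le> pi / 2"
      using m0 m1 arcsin_le_arcsin[of 0 "g / s * cos x"] arcsin_bounded[of "g / s * cos x"] by auto
    have "0 \<le> arcsin (1 / (g * s))" using gs arcsin_le_arcsin[of 0 "1 / (g * s)"] by simp
    then have Lb: "\<bar>x\<bar> \<le> Lbound w g"
      using True mult_nonneg_nonneg[of s "arcsin (1 / (g * s))"] s0
      unfolding Lbound_def s(2)[symmetric] by linarith
    have ph: "phiwg w g x = pi / 2 + s * arcsin (g / s * cos x)"
      using True by (simp add: phiwg_def flip: s(2))
    have phL: "phiwg w g x \<le> Lstar s" unfolding ph Lstar_def using as s0 by simp
    have "\<bar>y\<bar> < phiwg w g x \<longleftrightarrow> \<bar>y\<bar> < Lstar s \<and> 0 < g * cos x + gcos s y"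
    proof (cases "\<bar>y\<bar> < pi / 2")
      case True
      then have "0 < gcos s y" using gcos_pos_iff[OF s(1), of y] L by (simp add: Lstar_def)
      moreover have "0 \<le> g * cos x" using g0 c0 by simp
      moreover have "\<bar>y\<bar> < phiwg w g x" 
        unfolding ph using True mult_nonneg_nonneg[OF less_imp_le[OF s0] as(1)] by linarith
      ultimately show ?thesis using True L by auto
    next
      case False
      \<comment> \<open>In this angle the outer branch is -s sin th, and the cut-off reads th <
        pi/2.\<close>
      define th where "th = (\<bar>y\<bar> - pi / 2) / s"
      have th0: "0 \<le> th" using False s0 by (simp add: th_def)
      have gy: "gcos s y = - s * sin th" using False by (simp add: gcos_outer th_def)
      have pos: "0 < g * cos x + gcos s y \<longleftrightarrow> sin th < g / s * cos x"
        unfolding gy using s0 by (simp add: field_simps)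
      have phy: "\<bar>y\<bar> < phiwg w g x \<longleftrightarrow> th < arcsin (g / s * cos x)"
        unfolding ph th_def using s0 by (simp add: field_simps)
      have thL: "\<bar>y\<bar> < Lstar s \<longleftrightarrow> th < pi / 2"
        unfolding th_def Lstar_def pos_divide_less_eq[OF s0] mult.commute[of s] by linarith
      show ?thesis
      proof
        assume a: "\<bar>y\<bar> < phiwg w g x"
        then have "sin th < sin (arcsin (g / s * cos x))"
          using phy as th0 by (intro sin_monotone_2pi) auto
        then show "\<bar>y\<bar> < Lstar s \<and> 0 < g * cos x + gcos s y"
          using m0 m1 pos a phL by simp
      next
        assume a: "\<bar>y\<bar> < Lstar s \<and> 0 < g * cos x + gcos s y"
        then have "sin th < g / s * cos x" using pos by simp
        then have "arcsin (sin th) < arcsin (g / s * cos x)"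
          using m1 by (intro arcsin_less_arcsin) auto
        then show "\<bar>y\<bar> < phiwg w g x" using phy a thL th0 by (simp add: arcsin_sin)
      qed
    qed
    then show ?thesis using Lb True L gx by auto
  next
    case False
    define th where "th = (\<bar>x\<bar> - pi / 2) / s"
    have th0: "0 < th" using False s0 by (simp add: th_def)
    have gx: "gcos s x = - s * sin th" using False by (simp add: gcos_outer th_def)
    have ph: "phiwg w g x = arccos (g * s * sin th)"
      using False by (simp add: phiwg_def th_def flip: s(2))
    have Lb: "\<bar>x\<bar> \<le> Lbound w g \<longleftrightarrow> th \<le> arcsin (1 / (g * s))"
      unfolding th_def Lbound_def s(2)[symmetric] using s0 by (simp add: field_simps)
    have thL: "\<bar>x\<bar> < Lstar s \<longleftrightarrow> th < pi / 2" "\<bar>x\<bar> \<le> Lstar s \<longleftrightarrow> th \<le> pi / 2"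
      unfolding th_def Lstar_def pos_divide_less_eq[OF s0] pos_divide_le_eq[OF s0] mult.commute[of s]
      by linarith+
    have i: "0 \<le> 1 / (g * s)" "1 / (g * s) \<le> 1" using gs by auto
    have i': "- 1 \<le> 1 / (g * s)" "1 / (g * s) \<le> 1" using i by linarith+
    show ?thesis
    proof
      assume l: ?l
      have "arcsin (1 / (g * s)) \<le> pi / 2" using arcsin_bounded[OF i'] by blast
      then have th1: "th \<le> pi / 2" using l Lb by simp
      have "sin th \<le> sin (arcsin (1 / (g * s)))"
        using l Lb th0 arcsin_bounded[OF i'] by (intro sin_monotone_2pi_le) auto
      then have gs2: "g * s * sin th \<le> 1" using i gs by (simp add: field_simps)
      have sp: "0 < sin th" using th0 th1 by (intro sin_gt_zero) auto
      have gs3: "0 < g * s * sin th" using sp gs by simp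
      have "\<bar>y\<bar> < arccos (g * s * sin th)" using l ph by simp
      moreover have "arccos (g * s * sin th) \<le> pi / 2"
        using arccos_le_arccos[of 0 "g * s * sin th"] gs2 gs3 by simp
      ultimately have "cos (arccos (g * s * sin th)) < cos \<bar>y\<bar>"
        by (intro cos_monotone_0_pi) auto
      then have cy: "g * s * sin th < cos y" using gs2 gs3 by simp
      have y2: "\<bar>y\<bar> < pi / 2"
        using \<open>\<bar>y\<bar> < arccos _\<close> \<open>arccos (g * s * sin th) \<le> pi / 2\<close> by simp
      \<comment> \<open>Only in the extreme case g s = 1 does \<open>Lbound\<close> reach
        \<open>Lstar\<close>; there the admissible interval for y is empty.\<close>
      have "th \<noteq> pi / 2"
      proof
        assume "th = pi / 2"
        then have "sin th = 1" by (simp only: sin_pi_half)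
        with cy have "g * s < cos y" by simp
        then show False using gs cos_le_one[of y] by linarith
      qed
      then have "\<bar>x\<bar> < Lstar s" using thL th1 by simp
      moreover have "\<bar>y\<bar> < Lstar s" using y2 L by simp
      moreover have "0 < g * gcos s x + gcos s y" using cy y2 unfolding gx by (simp add: gcos_def)
      ultimately show ?r by blast
    next
      assume r: ?r
      then have th1: "th < pi / 2" using thL by simp
      have sp: "0 < sin th" using th0 th1 by (intro sin_gt_zero) auto
      have gs3: "0 < g * s * sin th" using sp gs by simp
      have gy: "g * s * sin th < gcos s y" using r unfolding gx by simp
      then have y2: "\<bar>y\<bar> < pi / 2" using gcos_pos_iff[OF s(1), of y] r gs3 by (simp add: Lstar_def)
      then have cy: "g * s * sin th < cos y" using gy by (simp add: gcos_def)
      then have "g * s * sin th < 1" using cos_le_one[of y] by linarith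
      then have "sin th < 1 / (g * s)" using gs by (simp add: field_simps)
      then have "arcsin (sin th) < arcsin (1 / (g * s))" using i by (intro arcsin_less_arcsin) auto
      then have "th \<le> arcsin (1 / (g * s))" using th0 th1 by (simp add: arcsin_sin)
      moreover have "arccos (cos \<bar>y\<bar>) < arccos (g * s * sin th)"
        using cy gs3 by (intro arccos_less_arccos) auto
      moreover have "arccos (cos \<bar>y\<bar>) = \<bar>y\<bar>" using y2 pi_gt_zero by (intro arccos_cos) linarith+
      ultimately show ?l using Lb ph by (simp only:)
    qed
  qed
  then show ?thesis by (auto simp: Omega_wg_def Usum_def)
qed

text \<open>A nonnegative sum excludes points with both coordinates beyond pi/2, so the three
  branches of \<open>u_wg\<close> suffice; on the common edges they agree because the cosine
  vanishes. Weak inequalities are assumed so that boundary points are covered.\<close>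

lemma u_wg_eq:
  assumes s: "1 \<le> s" "s = sqrt w" and g: "0 < g"
    and z: "\<bar>fst z\<bar> \<le> Lstar s" "\<bar>snd z\<bar> \<le> Lstar s" "0 \<le> Usum s g z"
  shows "u_wg w g z = Usum s g z"
proof -
  obtain x y where z': "z = (x, y)" by fastforce
  have 0: "gcos s t \<le> 0" if "pi / 2 \<le> \<bar>t\<bar>" "\<bar>t\<bar> \<le> Lstar s" for t
    using gcos_pos_iff[OF s(1), of t] that by (simp add: Lstar_def)
  have "\<bar>y\<bar> \<le> pi / 2 \<or> \<bar>x\<bar> < pi / 2"
  proof (rule ccontr)
    assume a: "\<not> ?thesis"
    have "gcos s y < gcos s (pi / 2)" using gcos_less[of s "pi / 2" y] a z s(1) by (simp add: z' Lstar_def)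
    moreover have "gcos s (pi / 2) = 0" by (simp add: gcos_def)
    moreover have "g * gcos s x \<le> 0" using 0[of x] a z g by (simp add: z' mult_nonneg_nonpos)
    ultimately show False using z(3) by (simp add: z' Usum_def)
  qed
  then consider "\<bar>x\<bar> < pi / 2" "\<bar>y\<bar> \<le> pi / 2" | "\<bar>x\<bar> < pi / 2" "\<not> \<bar>y\<bar> \<le> pi / 2"
    | "pi / 2 \<le> \<bar>x\<bar>" "\<bar>y\<bar> \<le> pi / 2"
    by linarith
  then show ?thesis
  proof cases
    case 3
    have c: "cos (v + pi / 2) = - sin v" for v :: real by (simp add: cos_add)
    have "u_wg w g z = g * s * cos ((\<bar>x\<bar> - pi / 2) / s + pi / 2) + cos y"
    proof (cases "\<bar>x\<bar> = pi / 2")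
      case True
      then have "cos x = 0" by (metis cos_abs_real cos_pi_half)
      then show ?thesis using 3 by (simp add: u_wg_def z' True)
    next
      case False
      then show ?thesis using 3 by (simp add: u_wg_def z' flip: s(2))
    qed
    then show ?thesis unfolding c Usum_def using 3 by (simp add: z' gcos_outer) (simp add: gcos_def)
  qed (simp_all add: u_wg_def z' Usum_def gcos_def cos_add flip: s(2))
qed

section \<open>The sheared domain, its compact hull and its boundary\<close>

definition Omega_star :: "real \<Rightarrow> real \<Rightarrow> real \<Rightarrow> (real \<times> real) set" where
  "Omega_star s g a = {z. \<bar>fst (Cmap_inv a z)\<bar> < Lstar s \<and> \<bar>snd (Cmap_inv a z)\<bar> < Lstar s \<and>
     0 < Usum s g (Cmap_inv a z)}"

definition Omega_star_closed :: "real \<Rightarrow> real \<Rightarrow> real \<Rightarrow> (real \<times> real) set" where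
  "Omega_star_closed s g a = {z. \<bar>fst (Cmap_inv a z)\<bar> \<le> Lstar s \<and> \<bar>snd (Cmap_inv a z)\<bar> \<le> Lstar s \<and>
     0 \<le> Usum s g (Cmap_inv a z)}"

lemma one_minus_shear_sq_pos:
  assumes "\<bar>a\<bar> < pi"
  shows "0 < 1 - (a / pi)\<^sup>2"
proof -
  have "(a / pi)\<^sup>2 < 1" using assms by (simp add: abs_square_less_1)
  then show ?thesis by simp
qed

lemma Omega_wga_eq:
  assumes "1 \<le> s" "s = sqrt w" "1 / s \<le> g" "g \<le> s" "\<bar>a\<bar> < pi"
  shows "Omega_wga w g a = Omega_star s g a"
proof -
  have c: "sqrt (1 - (a / pi)\<^sup>2) \<noteq> 0" using one_minus_shear_sq_pos[OF assms(5)] by simp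
  have inv: "Cmap_inv a (Cmap a z) = z" "Cmap a (Cmap_inv a z) = z" for z
    using c by (auto simp: Cmap_def Cmap_inv_def prod_eq_iff)
  have "Omega_star s g a = {z. Cmap_inv a z \<in> Omega_wg w g}"
    using Omega_wg_eq[OF assms(1-4)] by (simp add: Omega_star_def)
  moreover have "Cmap a ` A = {z. Cmap_inv a z \<in> A}" for A
  proof (intro set_eqI iffI)
    fix z assume "z \<in> {z. Cmap_inv a z \<in> A}"
    then show "z \<in> Cmap a ` A" using inv(2)[of z] by (intro image_eqI[of _ _ "Cmap_inv a z"]) simp_all
  qed (use inv(1) in auto)
  ultimately show ?thesis unfolding Omega_wga_def by simp
qed

lemma continuous_on_Cmap_inv [continuous_intros]:
  assumes "\<bar>a\<bar> < pi"
  shows "continuous_on S (Cmap_inv a)"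
  unfolding Cmap_inv_def using one_minus_shear_sq_pos[OF assms]
  by (intro continuous_intros) auto

lemma continuous_on_Usum: "0 < s \<Longrightarrow> continuous_on S (Usum s g)"
  unfolding Usum_def
  by (intro continuous_intros continuous_on_compose2[OF continuous_on_gcos]) auto

lemma
  assumes "0 < s" "\<bar>a\<bar> < pi"
  shows open_Omega_star: "open (Omega_star s g a)"
    and closed_Omega_star_closed: "closed (Omega_star_closed s g a)"
proof -
  note c = continuous_on_Cmap_inv[OF assms(2), of UNIV]
    continuous_on_compose2[OF continuous_on_Usum[OF assms(1), of UNIV g] continuous_on_Cmap_inv[OF assms(2), of UNIV]]
  show "open (Omega_star s g a)"
    unfolding Omega_star_def using c assms
    by (intro open_Collect_conj open_Collect_less continuous_intros) auto
  show "closed (Omega_star_closed s g a)"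
    unfolding Omega_star_closed_def using c assms
    by (intro closed_Collect_conj closed_Collect_le continuous_intros) auto
qed

lemma Omega_star_subset: "Omega_star s g a \<subseteq> Omega_star_closed s g a"
  by (auto simp: Omega_star_def Omega_star_closed_def)

lemma compact_Omega_star_closed:
  assumes "0 < s" "\<bar>a\<bar> < pi"
  shows "compact (Omega_star_closed s g a)"
proof -
  have c: "sqrt (1 - (a / pi)\<^sup>2) \<noteq> 0" using one_minus_shear_sq_pos[OF assms(2)] by simp
  have "Omega_star_closed s g a \<subseteq> Cmap a ` ({- Lstar s..Lstar s} \<times> {- Lstar s..Lstar s})"
  proof
    fix z assume "z \<in> Omega_star_closed s g a"
    then have "Cmap_inv a z \<in> {- Lstar s..Lstar s} \<times> {- Lstar s..Lstar s}"
      by (auto simp: Omega_star_closed_def mem_Times_iff)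
    moreover have "z = Cmap a (Cmap_inv a z)" using c by (simp add: Cmap_def Cmap_inv_def prod_eq_iff)
    ultimately show "z \<in> Cmap a ` ({- Lstar s..Lstar s} \<times> {- Lstar s..Lstar s})" by (rule rev_image_eqI)
  qed
  moreover have "compact (Cmap a ` ({- Lstar s..Lstar s} \<times> {- Lstar s..Lstar s}))"
    unfolding Cmap_def by (intro compact_continuous_image continuous_intros compact_Times compact_Icc)
  ultimately show ?thesis
    using closed_Omega_star_closed[OF assms] by (meson bounded_subset compact_eq_bounded_closed)
qed

text \<open>A boundary point might lie on the cut-off rather than on the zero set. But there one
  profile equals -s, the other is at most 1, and 1/s \<le> g \<le> s makes the sum nonpositive
  anyway.\<close>

lemma Omega_star_boundary:
  assumes s: "1 \<le> s" and g: "1 / s \<le> g" "g \<le> s"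
    and z: "z \<in> Omega_star_closed s g a" "z \<notin> Omega_star s g a"
  shows "Usum s g (Cmap_inv a z) = 0"
proof -
  obtain x y where xy: "Cmap_inv a z = (x, y)" by fastforce
  have g0: "0 < g" using g s less_le_trans[of 0 "1 / s" g] by simp
  have gs: "1 \<le> g * s" using g s by (simp add: field_simps)
  have b: "\<bar>x\<bar> \<le> Lstar s" "\<bar>y\<bar> \<le> Lstar s" "0 \<le> g * gcos s x + gcos s y"
    using z(1) by (auto simp: Omega_star_closed_def xy Usum_def)
  have u: "gcos s x \<le> 1" "gcos s y \<le> 1" using b s by (auto intro: gcos_le_1 simp: Lstar_def)
  consider "g * gcos s x + gcos s y \<le> 0" | "\<bar>x\<bar> = Lstar s" | "\<bar>y\<bar> = Lstar s"
    using z b by (fastforce simp: Omega_star_def xy Usum_def)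
  then have "g * gcos s x + gcos s y \<le> 0"
  proof cases
    case 2
    then show ?thesis using gcos_end[OF s, of x] u gs by (simp add: Lstar_def)
  next
    case 3
    then have "gcos s y = - s" using gcos_end[OF s, of y] by (simp add: Lstar_def)
    moreover have "g * gcos s x \<le> g" using u g0 by simp
    ultimately show ?thesis using g by simp
  qed
  then show ?thesis using b by (simp add: xy Usum_def)
qed

section \<open>The eigenfunction and the comparison argument\<close>

lemma Cmap_inv_scaleR: "Cmap_inv a (\<theta> *\<^sub>R z) = \<theta> *\<^sub>R Cmap_inv a z"
  by (simp add: Cmap_inv_def prod_eq_iff algebra_simps)

lemma pucci_plus_diag: "pucci_plus lam Lam p 0 r = pucci_weight lam Lam p + pucci_weight lam Lam r"
  by (cases "p \<le> r") (simp_all add: pucci_plus_def sym2_eig_lo_def sym2_eig_hi_def)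

lemma gcos2_linear: "gcos2 1 t = - gcos 1 t"
  by (simp add: gcos_def gcos2_def)

text \<open>The rows of the inverse shear are (1/c, 0) and (-k/c, 1) with k = a/pi. The
  normalization k^2 + c^2 = 1 gives them equal length; their inner product -k/c^2 vanishes only for
  a = 0.\<close>

lemma ridge_norms:
  assumes "\<bar>a\<bar> < pi" and c: "c = sqrt (1 - (a / pi)\<^sup>2)"
  shows "0 < c" "1 / c\<^sup>2 = pi\<^sup>2 / (pi\<^sup>2 - a\<^sup>2)" "(a / pi)\<^sup>2 + c\<^sup>2 = 1"
    "(1 / c)\<^sup>2 + 0\<^sup>2 = 1 / c\<^sup>2" "(- (a / pi) / c)\<^sup>2 + 1\<^sup>2 = 1 / c\<^sup>2"
proof -
  note pos = one_minus_shear_sq_pos[OF assms(1)]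
  show c0: "0 < c" using pos c by simp
  have c2: "c\<^sup>2 = 1 - (a / pi)\<^sup>2" using pos c by simp
  then show 1: "(a / pi)\<^sup>2 + c\<^sup>2 = 1" by simp
  show "1 / c\<^sup>2 = pi\<^sup>2 / (pi\<^sup>2 - a\<^sup>2)"
    unfolding c2 power_divide by (simp add: diff_divide_distrib[symmetric] diff_divide_eq_iff)
  show "(1 / c)\<^sup>2 + 0\<^sup>2 = 1 / c\<^sup>2" by (simp add: power_divide)
  have "((a / pi)\<^sup>2 + c\<^sup>2) / c\<^sup>2 = 1 / c\<^sup>2" by (simp add: 1)
  then show "(- (a / pi) / c)\<^sup>2 + 1\<^sup>2 = 1 / c\<^sup>2"
    using c0 by (simp add: add_divide_distrib power_divide power_mult_distrib)
qed

lemma Cmap_inv_ridge: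
  assumes "c = sqrt (1 - (a / pi)\<^sup>2)"
  shows "fst (Cmap_inv a z) = (1 / c) * fst z + 0 * snd z"
    "snd (Cmap_inv a z) = (- (a / pi) / c) * fst z + 1 * snd z"
  using assms by (simp_all add: Cmap_inv_def)

text \<open>With \<kappa> = \<theta> = 1 this is the eigenfunction itself; \<theta> > 1 and a
  reciprocal \<kappa> give the multiple of the shrunk copy used for comparison.\<close>

lemma has_hess_Usum:
  assumes s: "0 < s" and c: "c = sqrt (1 - (a / pi)\<^sup>2)"
  shows "has_hess (\<lambda>z. \<kappa> * Usum s g (Cmap_inv a (\<theta> *\<^sub>R z)))
    (\<lambda>z. (\<kappa> * g * gcos2 s (fst (Cmap_inv a (\<theta> *\<^sub>R z)))) * ((\<theta> / c) * (\<theta> / c))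
       + (\<kappa> * gcos2 s (snd (Cmap_inv a (\<theta> *\<^sub>R z)))) * ((- (a / pi) * \<theta> / c) * (- (a / pi) * \<theta> / c)))
    (\<lambda>z. (\<kappa> * g * gcos2 s (fst (Cmap_inv a (\<theta> *\<^sub>R z)))) * ((\<theta> / c) * 0)
       + (\<kappa> * gcos2 s (snd (Cmap_inv a (\<theta> *\<^sub>R z)))) * ((- (a / pi) * \<theta> / c) * \<theta>))
    (\<lambda>z. (\<kappa> * g * gcos2 s (fst (Cmap_inv a (\<theta> *\<^sub>R z)))) * (0 * 0)
       + (\<kappa> * gcos2 s (snd (Cmap_inv a (\<theta> *\<^sub>R z)))) * (\<theta> * \<theta>))"
proof -
  have x: "fst (Cmap_inv a (\<theta> *\<^sub>R z)) = \<theta> / c * fst z + 0 * snd z"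
    and y: "snd (Cmap_inv a (\<theta> *\<^sub>R z)) = - (a / pi) * \<theta> / c * fst z + \<theta> * snd z" for z
    by (simp_all add: Cmap_inv_def c)
  have u: "\<kappa> * Usum s g (Cmap_inv a (\<theta> *\<^sub>R z)) = \<kappa> * g * gcos s (\<theta> / c * fst z + 0 * snd z)
      + \<kappa> * gcos s (- (a / pi) * \<theta> / c * fst z + \<theta> * snd z)" for z
    unfolding Usum_def x y by (simp add: algebra_simps)
  note r = has_hess_ridge[OF DERIV_gcos[OF s] DERIV_gcos1[OF s] continuous_on_gcos2[OF s]]
  show ?thesis unfolding x y u by (rule has_hess_add[OF r r])
qed

lemma Lstar_le: "0 < s \<Longrightarrow> Lstar s \<le> pi / 2 + s * pi"
  using mult_left_mono[of "pi / 2" pi s] by (simp add: Lstar_def)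

lemma pucci_Usum_le:
  assumes s: "0 < s" and g: "0 \<le> g" and a: "\<bar>a\<bar> < pi" and c: "c = sqrt (1 - (a / pi)\<^sup>2)"
    and lam: "0 < lam" "lam \<le> Lam" "Lam = s\<^sup>2 * lam"
    and z: "z \<in> Omega_star_closed s g a"
  shows "pucci_plus lam Lam
     ((g * gcos2 s (fst (Cmap_inv a z))) * ((1 / c) * (1 / c))
       + (gcos2 s (snd (Cmap_inv a z))) * ((- (a / pi) / c) * (- (a / pi) / c)))
     ((g * gcos2 s (fst (Cmap_inv a z))) * ((1 / c) * 0)
       + (gcos2 s (snd (Cmap_inv a z))) * ((- (a / pi) / c) * 1))
     ((g * gcos2 s (fst (Cmap_inv a z))) * (0 * 0)
       + (gcos2 s (snd (Cmap_inv a z))) * (1 * 1)) \<le> - (lam / c\<^sup>2) * Usum s g (Cmap_inv a z)"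
proof -
  have b: "\<bar>fst (Cmap_inv a z)\<bar> \<le> pi / 2 + s * pi" "\<bar>snd (Cmap_inv a z)\<bar> \<le> pi / 2 + s * pi"
    using z Lstar_le[OF s] unfolding Omega_star_closed_def by auto
  note w1 = gcos_weight[OF s b(1) lam(1,3) g] and w2 = gcos_weight[OF s b(2) lam(1,3) zero_le_one]
  show ?thesis
    by (rule order_trans[OF pucci_plus_subadd[OF lam(2)]])
      (use w1 w2 in \<open>simp only: pucci_plus_ridge ridge_norms(4,5)[OF a c], simp add: Usum_def algebra_simps\<close>)
qed

text \<open>For s = 1 the operator is \<lambda> times the trace and the profile is the cosine
  everywhere; for a = 0 the Hessian is diagonal and the weights add. Either way subadditivity loses
  nothing.\<close>

lemma pucci_Usum_eq:
  assumes s: "0 < s" and g: "0 \<le> g" and a: "\<bar>a\<bar> < pi" and c: "c = sqrt (1 - (a / pi)\<^sup>2)"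
    and lam: "0 < lam" "Lam = s\<^sup>2 * lam" and triv: "s = 1 \<or> a = 0" and \<kappa>: "0 \<le> \<kappa>"
    and z: "\<theta> *\<^sub>R z \<in> Omega_star_closed s g a"
  shows "pucci_hess lam Lam (\<lambda>z. \<kappa> * Usum s g (Cmap_inv a (\<theta> *\<^sub>R z))) z
    = - (lam / c\<^sup>2) * \<theta>\<^sup>2 * (\<kappa> * Usum s g (Cmap_inv a (\<theta> *\<^sub>R z)))"
proof -
  define x where "x = fst (Cmap_inv a (\<theta> *\<^sub>R z))"
  define y where "y = snd (Cmap_inv a (\<theta> *\<^sub>R z))"
  note h = has_hess_pucci[OF has_hess_Usum[OF s c], of lam Lam \<kappa> g \<theta> z, folded x_def y_def]
  have u: "Usum s g (Cmap_inv a (\<theta> *\<^sub>R z)) = g * gcos s x + gcos s y"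
    by (simp add: Usum_def x_def y_def)
  from triv show ?thesis
  proof
    assume s1: "s = 1"
    then have L: "Lam = lam" using lam by simp
    have "(- (a / pi) * \<theta> / c) * (- (a / pi) * \<theta> / c) + \<theta> * \<theta> = \<theta>\<^sup>2 * ((- (a / pi) / c)\<^sup>2 + 1\<^sup>2)"
      by (simp add: power2_eq_square algebra_simps)
    then have n: "(- (a / pi) * \<theta> / c) * (- (a / pi) * \<theta> / c) + \<theta> * \<theta> = \<theta>\<^sup>2 * (1 / c\<^sup>2)"
      unfolding ridge_norms(5)[OF a c] .
    have n': "(\<theta> / c) * (\<theta> / c) = \<theta>\<^sup>2 * (1 / c\<^sup>2)" by (simp add: power2_eq_square)
    have "pucci_hess lam Lam (\<lambda>z. \<kappa> * Usum s g (Cmap_inv a (\<theta> *\<^sub>R z))) z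
        = lam * ((\<kappa> * g * gcos2 s x) * ((\<theta> / c) * (\<theta> / c))
          + (\<kappa> * gcos2 s y) * ((- (a / pi) * \<theta> / c) * (- (a / pi) * \<theta> / c) + \<theta> * \<theta>))"
      unfolding h[unfolded L] pucci_plus_eq L by (simp add: distrib_left)
    also have "\<dots> = lam * ((\<kappa> * g * gcos2 s x) * (\<theta>\<^sup>2 * (1 / c\<^sup>2)) + (\<kappa> * gcos2 s y) * (\<theta>\<^sup>2 * (1 / c\<^sup>2)))"
      unfolding n n' ..
    also have "\<dots> = - (lam / c\<^sup>2) * \<theta>\<^sup>2 * (\<kappa> * (g * gcos s x + gcos s y))"
      by (simp add: s1 gcos2_linear algebra_simps add_divide_distrib)
    finally show ?thesis unfolding u .
  next
    assume a0: "a = 0"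
    have b: "\<bar>x\<bar> \<le> pi / 2 + s * pi" "\<bar>y\<bar> \<le> pi / 2 + s * pi"
      using z Lstar_le[OF s] unfolding Omega_star_closed_def x_def y_def by auto
    have c1: "c = 1" using c a0 by simp
    have "pucci_hess lam Lam (\<lambda>z. \<kappa> * Usum s g (Cmap_inv a (\<theta> *\<^sub>R z))) z
        = pucci_weight lam Lam ((\<theta>\<^sup>2 * \<kappa> * g) * gcos2 s x) + pucci_weight lam Lam ((\<theta>\<^sup>2 * \<kappa>) * gcos2 s y)"
      unfolding h unfolding a0 c1 by (simp add: pucci_plus_diag power2_eq_square mult_ac)
    also have "\<dots> = - lam * ((\<theta>\<^sup>2 * \<kappa> * g) * gcos s x) + - lam * ((\<theta>\<^sup>2 * \<kappa>) * gcos s y)"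
      using b s g lam \<kappa> by (intro arg_cong2[of _ _ _ _ "(+)"] gcos_weight) auto
    finally show ?thesis unfolding u c1 by (simp add: algebra_simps)
  qed
qed

text \<open>The profile strictly decreases in |t|, so the domain is strictly star-shaped about the
  origin and a shrunk closed copy fits into the open set.\<close>

lemma scaled_closed_subset:
  assumes s: "1 \<le> s" and g: "0 < g" and \<theta>: "1 < \<theta>" and z: "\<theta> *\<^sub>R z \<in> Omega_star_closed s g a"
  shows "z \<in> Omega_star s g a"
proof -
  obtain x y where xy: "Cmap_inv a z = (x, y)" by fastforce
  have L: "0 < Lstar s" using s by (simp add: Lstar_def add_pos_pos)
  have b: "\<bar>\<theta> * x\<bar> \<le> Lstar s" "\<bar>\<theta> * y\<bar> \<le> Lstar s" "0 \<le> g * gcos s (\<theta> * x) + gcos s (\<theta> * y)"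
    using z by (auto simp: Omega_star_closed_def Cmap_inv_scaleR xy Usum_def)
  have lt: "\<bar>t\<bar> < \<bar>\<theta> * t\<bar>" if "t \<noteq> 0" for t
    using \<theta> that by (simp add: abs_mult)
  have m: "\<bar>t\<bar> < Lstar s \<and> gcos s (\<theta> * t) \<le> gcos s t \<and> (t \<noteq> 0 \<longrightarrow> gcos s (\<theta> * t) < gcos s t)"
    if "\<bar>\<theta> * t\<bar> \<le> Lstar s" for t
    using gcos_less[of s t "\<theta> * t"] lt[of t] that s L by (cases "t = 0") (auto simp: Lstar_def)
  have "0 < g * gcos s x + gcos s y"
  proof (cases "x = 0")
    case True
    show ?thesis
    proof (cases "y = 0")
      case True
      then show ?thesis using \<open>x = 0\<close> g by (simp add: gcos_def)
    next
      case False
      then show ?thesis using m[OF b(2)] b(3) \<open>x = 0\<close> by simp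
    qed
  next
    case False
    then have "g * gcos s (\<theta> * x) < g * gcos s x" using m[OF b(1)] g by simp
    then show ?thesis using m[OF b(2)] b(3) by simp
  qed
  then show ?thesis using m[OF b(1)] m[OF b(2)] by (simp add: Omega_star_def xy Usum_def)
qed

text \<open>A positive supersolution is touched from below by the largest multiple of the slightly shrunk
  eigenfunction \<open>U(\<theta> z)\<close>, which solves the equation with \<open>\<theta>\<^sup>2 \<mu>\<close> and vanishes on the boundary
  of the shrunk domain.\<close>

lemma supersol_le_eigenvalue:
  assumes s: "1 \<le> s" and g: "1 / s \<le> g" "g \<le> s" and a: "\<bar>a\<bar> < pi" and c: "c = sqrt (1 - (a / pi)\<^sup>2)"
    and lam: "0 < lam" "Lam = s\<^sup>2 * lam" and triv: "s = 1 \<or> a = 0"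
    and phi: "continuous_on (Omega_star s g a) phi" "\<And>z. z \<in> Omega_star s g a \<Longrightarrow> 0 < phi z"
    and super: "visc_supersol lam Lam mu (Omega_star s g a) phi"
  shows "mu \<le> lam / c\<^sup>2"
proof (rule ccontr)
  assume "\<not> mu \<le> lam / c\<^sup>2"
  define mu0 where "mu0 = lam / c\<^sup>2"
  have mu: "mu0 < mu" using \<open>\<not> _\<close> by (simp add: mu0_def)
  have s0: "0 < s" using s by simp
  have g0: "0 < g" using g s less_le_trans[of 0 "1 / s" g] by simp
  have mu0: "0 < mu0" using ridge_norms(1)[OF a c] lam by (simp add: mu0_def)
  \<comment> \<open>Chosen so that the eigenvalue \<theta>^2 mu0 of the shrunk copy is the midpoint
    of mu0 and mu.\<close>
  define \<theta> where "\<theta> = sqrt ((mu + mu0) / (2 * mu0))"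
  have \<theta>2: "mu0 * \<theta>\<^sup>2 = (mu + mu0) / 2" using mu mu0 by (simp add: \<theta>_def)
  have \<theta>: "1 < \<theta>" using mu mu0 by (simp add: \<theta>_def)
  let ?U = "\<lambda>z. Usum s g (Cmap_inv a (\<theta> *\<^sub>R z))"
  define K where "K = (\<lambda>z. (1 / \<theta>) *\<^sub>R z) ` Omega_star_closed s g a"
  have K: "z \<in> K \<longleftrightarrow> \<theta> *\<^sub>R z \<in> Omega_star_closed s g a" for z
    using \<theta> by (auto simp: K_def intro!: image_eqI[of _ _ "\<theta> *\<^sub>R z"])
  have "compact K" unfolding K_def
    by (intro compact_continuous_image compact_Omega_star_closed continuous_intros s0 a)
  have KO: "K \<subseteq> Omega_star s g a" using scaled_closed_subset[OF s g0 \<theta>] K by blast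
  have U0: "?U 0 = g + 1" by (simp add: Usum_def Cmap_inv_def gcos_def)
  have 0: "0 \<in> K" using s g0 by (simp add: K Omega_star_closed_def Cmap_inv_def Usum_def gcos_def Lstar_def)
  have cU: "continuous_on UNIV ?U"
    by (intro continuous_on_compose2[OF continuous_on_Usum[OF s0, of UNIV]] 
        continuous_on_compose2[OF continuous_on_Cmap_inv[OF a, of UNIV]] continuous_intros) auto
  have "continuous_on K (\<lambda>z. ?U z / phi z)"
    using KO phi continuous_on_subset[OF cU] by (intro continuous_on_divide) (auto intro: continuous_on_subset dest: order_less_imp_not_eq2)
  then obtain z0 where z0: "z0 \<in> K" "\<And>z. z \<in> K \<Longrightarrow> ?U z / phi z \<le> ?U z0 / phi z0"
    using continuous_attains_sup[OF \<open>compact K\<close>] 0 by blast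
  define M where "M = ?U z0 / phi z0"
  have "0 < ?U 0 / phi 0" unfolding U0 using 0 KO phi(2)[of 0] g0 by auto
  then have M: "0 < M" using z0(2)[OF 0] unfolding M_def by linarith
  have p0: "0 < phi z0" using z0(1) KO phi(2) by blast
  have eq: "?U z0 / M = phi z0" using M p0 by (simp add: M_def field_simps)
  \<comment> \<open>The shrunk copy vanishes at the edge of \<open>K\<close>, whereas the maximal
    ratio is positive; so the contact point is interior and a test function is legitimate
    there.\<close>
  have "?U z0 \<noteq> 0" using M by (auto simp: M_def)
  then have in0: "\<theta> *\<^sub>R z0 \<in> Omega_star s g a"
    using Omega_star_boundary[OF s g] z0(1) K by blast
  have "open ((\<lambda>z. \<theta> *\<^sub>R z) -` Omega_star s g a)"
    by (intro open_vimage open_Omega_star s0 a continuous_intros)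
  then obtain r where r: "0 < r" "ball z0 r \<subseteq> (\<lambda>z. \<theta> *\<^sub>R z) -` Omega_star s g a"
    using in0 openE by blast
  have rK: "ball z0 r \<subseteq> K" using r(2) Omega_star_subset K by fastforce
  define psi where "psi = (\<lambda>z. (1 / M) * ?U z)"
  have "pucci_hess lam Lam psi z0 + mu * phi z0 \<le> 0"
  proof (rule super[unfolded visc_supersol_def, rule_format])
    show "z0 \<in> Omega_star s g a" using z0(1) KO by blast
    show "0 < r" by fact
    show "C2_on (ball z0 r) psi" unfolding psi_def by (rule has_hess_C2_on[OF has_hess_Usum[OF s0 c]])
    fix z assume "z \<in> Omega_star s g a \<inter> ball z0 r"
    then have "z \<in> K" using rK by blast
    then have "?U z / phi z \<le> M" "0 < phi z" using z0(2)[of z] KO phi(2)[of z] by (auto simp: M_def)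
    then have "?U z / M \<le> phi z" using M by (simp add: field_simps)
    then show "phi z0 - psi z0 \<le> phi z - psi z" using eq by (simp add: psi_def)
  qed
  moreover have "pucci_hess lam Lam psi z0 = - mu0 * \<theta>\<^sup>2 * ((1 / M) * ?U z0)"
    unfolding psi_def mu0_def using M z0(1) K g0 by (intro pucci_Usum_eq s0 a c lam triv) auto
  ultimately have "(mu - mu0 * \<theta>\<^sup>2) * phi z0 \<le> 0" using eq by (simp add: algebra_simps)
  then show False using p0 mu unfolding \<theta>2 by (simp add: mult_le_0_iff)
qed

section \<open>A better supersolution in the sheared nonlinear case\<close>

definition pcube :: "real \<Rightarrow> real" where
  "pcube u = (max 0 u) ^ 3"

lemma DERIV_pcube: "(pcube has_real_derivative 3 * (max 0 u)\<^sup>2) (at u)"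
proof -
  have 1: "pcube = (\<lambda>u. if u \<le> 0 then 0 else u ^ 3)"
    by (auto simp: pcube_def fun_eq_iff max_def)
  have 2: "3 * (max 0 u)\<^sup>2 = (if u \<le> 0 then 0 else 3 * u\<^sup>2)" by (auto simp: max_def)
  show ?thesis unfolding 1 2 by (rule DERIV_glue) (auto intro!: derivative_eq_intros)
qed

lemma DERIV_max0_power2: "((\<lambda>u. 3 * (max 0 u)\<^sup>2) has_real_derivative 6 * max 0 u) (at u)"
proof -
  have 1: "(\<lambda>u::real. 3 * (max 0 u)\<^sup>2) = (\<lambda>u. if u \<le> 0 then 0 else 3 * u\<^sup>2)"
    by (auto simp: fun_eq_iff max_def)
  have 2: "6 * max 0 u = (if u \<le> 0 then 0 else 6 * u)" by (auto simp: max_def)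
  show ?thesis unfolding 1 2 by (rule DERIV_glue) (auto intro!: derivative_eq_intros)
qed

text \<open>Even, zero for |t| \<le> b and cubic beyond; the cube is the lowest integer power that
  keeps the second derivative continuous at the junction.\<close>

definition bump :: "real \<Rightarrow> real \<Rightarrow> real" where
  "bump b t = pcube (t - b) + pcube (- t - b)"

definition bump1 :: "real \<Rightarrow> real \<Rightarrow> real" where
  "bump1 b t = 3 * (max 0 (t - b))\<^sup>2 - 3 * (max 0 (- t - b))\<^sup>2"

definition bump2 :: "real \<Rightarrow> real \<Rightarrow> real" where
  "bump2 b t = 6 * max 0 (t - b) + 6 * max 0 (- t - b)"

lemma DERIV_bump: "(bump b has_real_derivative bump1 b t) (at t)"
  unfolding bump_def bump1_def
  by (rule derivative_eq_intros DERIV_chain2[OF DERIV_pcube] refl | simp)+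

lemma DERIV_bump1: "(bump1 b has_real_derivative bump2 b t) (at t)"
  unfolding bump1_def bump2_def
  by (rule derivative_eq_intros DERIV_chain2[OF DERIV_max0_power2] refl | simp)+

lemma continuous_on_bump: "continuous_on UNIV (bump b)"
  by (meson DERIV_bump DERIV_isCont continuous_at_imp_continuous_on)

lemma continuous_on_bump2: "continuous_on UNIV (bump2 b)"
  unfolding bump2_def by (intro continuous_intros)

lemma bump_nonneg: "0 \<le> bump b t"
  by (simp add: bump_def pcube_def)

lemma bump_zero: "\<bar>t\<bar> \<le> b \<Longrightarrow> bump b t = 0 \<and> bump2 b t = 0"
  by (auto simp: bump_def bump2_def pcube_def)

lemma bump_ge:
  assumes "0 \<le> d" "b + d \<le> \<bar>t\<bar>"
  shows "d ^ 3 \<le> bump b t"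
proof -
  have "d ^ 3 \<le> pcube (\<bar>t\<bar> - b)" using assms unfolding pcube_def by (intro power_mono) auto
  moreover have "0 \<le> pcube u" for u by (simp add: pcube_def)
  ultimately show ?thesis unfolding bump_def by (cases "0 \<le> t") (auto intro: add_increasing add_increasing2)
qed

section \<open>Rotated and dilated coordinates\<close>

definition sig :: "real \<Rightarrow> real" where "sig \<tau> = 1 - \<tau>\<^sup>2 / 4"

lemma sig_minus [simp]: "sig (- \<tau>) = sig \<tau>" by (simp add: sig_def)

lemma sig_zero [simp]: "sig 0 = 1" by (simp add: sig_def)

lemma continuous_on_sig [continuous_intros]: "continuous_on S f \<Longrightarrow> continuous_on S (\<lambda>z. sig (f z))"
  unfolding sig_def by (intro continuous_intros) auto

text \<open>Coefficients of the linear map \<open>(X, Y) \<mapsto> C\<^sub>a\<^sup>-\<^sup>1 (sig \<tau> (X - \<tau> Y, Y + \<tau> X))\<close>, a rotation and dilation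
  followed by the inverse shear, where \<open>c = sqrt (1 - k\<^sup>2)\<close> and \<open>k = a / \<pi>\<close>.\<close>

definition xa where "xa c \<tau> = sig \<tau> / (c::real)"
definition xb where "xb c \<tau> = - sig \<tau> * \<tau> / (c::real)"
definition ya where "ya c k \<tau> = sig \<tau> * (\<tau> - k / (c::real))"
definition yb where "yb c k \<tau> = sig \<tau> * (1 + \<tau> * k / (c::real))"

lemma coeff_zero [simp]: "xa c 0 = 1 / c" "xb c 0 = 0" "ya c k 0 = - k / c" "yb c k 0 = 1"
  by (simp_all add: xa_def xb_def ya_def yb_def)

definition xr :: "real \<Rightarrow> real \<Rightarrow> real \<times> real \<Rightarrow> real" where
  "xr c \<tau> z = xa c \<tau> * fst z + xb c \<tau> * snd z"
definition yr :: "real \<Rightarrow> real \<Rightarrow> real \<Rightarrow> real \<times> real \<Rightarrow> real" where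
  "yr c k \<tau> z = ya c k \<tau> * fst z + yb c k \<tau> * snd z"

text \<open>Rotation and dilation act conformally, so both covectors keep a common length; its
  square acquires the factor that multiplies the eigenvalue.\<close>

lemma coeff_norms:
  assumes "0 < c" "k\<^sup>2 + c\<^sup>2 = 1"
  shows "(xa c \<tau>)\<^sup>2 + (xb c \<tau>)\<^sup>2 = (sig \<tau>)\<^sup>2 * (1 + \<tau>\<^sup>2) / c\<^sup>2"
    "(ya c k \<tau>)\<^sup>2 + (yb c k \<tau>)\<^sup>2 = (sig \<tau>)\<^sup>2 * (1 + \<tau>\<^sup>2) / c\<^sup>2"
proof -
  show "(xa c \<tau>)\<^sup>2 + (xb c \<tau>)\<^sup>2 = (sig \<tau>)\<^sup>2 * (1 + \<tau>\<^sup>2) / c\<^sup>2"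
    by (simp add: xa_def xb_def power_divide power_mult_distrib add_divide_distrib distrib_left)
  have "(ya c k \<tau>)\<^sup>2 + (yb c k \<tau>)\<^sup>2 = (sig \<tau>)\<^sup>2 * ((\<tau> - k / c)\<^sup>2 + (1 + \<tau> * k / c)\<^sup>2)"
    by (simp only: ya_def yb_def power_mult_distrib distrib_left[of "(sig \<tau>)\<^sup>2"])
  also have "(\<tau> - k / c)\<^sup>2 + (1 + \<tau> * k / c)\<^sup>2 = (1 + \<tau>\<^sup>2) * (k\<^sup>2 + c\<^sup>2) / c\<^sup>2"
    using assms(1) by (simp add: power2_eq_square field_simps)
  finally show "(ya c k \<tau>)\<^sup>2 + (yb c k \<tau>)\<^sup>2 = (sig \<tau>)\<^sup>2 * (1 + \<tau>\<^sup>2) / c\<^sup>2" using assms(2) by simp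
qed

text \<open>\<open>xh\<close> and \<open>yh\<close> are the components of the inverse shear applied
  to the quarter turn (-Y, X): the velocity of the sheared coordinates under the rotation, before
  the factor \<open>sig\<close>.\<close>

definition xh :: "real \<Rightarrow> real \<times> real \<Rightarrow> real" where
  "xh c z = - snd z / c"
definition yh :: "real \<Rightarrow> real \<Rightarrow> real \<times> real \<Rightarrow> real" where
  "yh c k z = fst z + k * snd z / c"

lemma xr_eq: "xr c \<tau> z = sig \<tau> * (xr c 0 z + \<tau> * xh c z)"
  by (simp add: xr_def xa_def xb_def xh_def algebra_simps)

lemma yr_eq: "yr c k \<tau> z = sig \<tau> * (yr c k 0 z + \<tau> * yh c k z)"
  by (simp add: yr_def ya_def yb_def yh_def algebra_simps)

text \<open>Undoing the shear expresses the velocities through the sheared coordinates x, y: they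
  are -(k x + y)/c and (x + k y)/c, with |k| \<le> 1.\<close>

lemma abs_xh_yh_le:
  assumes c: "0 < c" "k\<^sup>2 + c\<^sup>2 = 1" and L: "\<bar>xr c 0 z\<bar> \<le> L" "\<bar>yr c k 0 z\<bar> \<le> L"
  shows "\<bar>xh c z\<bar> \<le> 2 * L / c" "\<bar>yh c k z\<bar> \<le> 2 * L / c"
proof -
  have k: "\<bar>k\<bar> \<le> 1" using c zero_le_power2[of c] unfolding abs_square_le_1[symmetric] by linarith
  have kx: "\<bar>k * t\<bar> \<le> L" if "\<bar>t\<bar> \<le> L" for t
    using mult_mono[OF k that] by (simp add: abs_mult)
  have "xh c z = - (k * xr c 0 z + yr c k 0 z) / c"
    using c(1) by (simp add: xh_def xr_def yr_def)
  then have "\<bar>xh c z\<bar> = \<bar>k * xr c 0 z + yr c k 0 z\<bar> / c" using c(1) by simp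
  also have "\<dots> \<le> 2 * L / c"
    using kx[OF L(1)] L(2) c(1) by (intro divide_right_mono) linarith+
  finally show "\<bar>xh c z\<bar> \<le> 2 * L / c" .
  have "yh c k z = (xr c 0 z + k * yr c k 0 z) / c"
  proof -
    have "(xr c 0 z + k * yr c k 0 z) / c = ((1 - k\<^sup>2) * fst z / c + k * snd z) / c"
      by (simp add: xr_def yr_def algebra_simps power2_eq_square diff_divide_distrib)
    also have "1 - k\<^sup>2 = c\<^sup>2" using c(2) by simp
    finally show ?thesis using c(1) by (simp add: yh_def power2_eq_square add_divide_distrib)
  qed
  then have "\<bar>yh c k z\<bar> = \<bar>xr c 0 z + k * yr c k 0 z\<bar> / c" using c(1) by simp
  also have "\<dots> \<le> 2 * L / c"
    using kx[OF L(2)] L(1) c(1) by (intro divide_right_mono) linarith+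
  finally show "\<bar>yh c k z\<bar> \<le> 2 * L / c" .
qed

text \<open>The factor \<open>1 *\<close> gives both summands the form of a scaled ridge
  function.\<close>

definition Wf :: "real \<Rightarrow> real \<Rightarrow> real \<Rightarrow> real \<Rightarrow> real \<Rightarrow> real \<times> real \<Rightarrow> real" where
  "Wf s g c k \<tau> z = g * gcos s (xr c \<tau> z) + 1 * gcos s (yr c k \<tau> z)"

definition Wp :: "real \<Rightarrow> real \<Rightarrow> real \<Rightarrow> real \<Rightarrow> real \<Rightarrow> real \<times> real \<Rightarrow> real" where
  "Wp s g c k \<tau> z = (g * gcos2 s (xr c \<tau> z)) * (xa c \<tau> * xa c \<tau>)
     + (1 * gcos2 s (yr c k \<tau> z)) * (ya c k \<tau> * ya c k \<tau>)"

definition Wq :: "real \<Rightarrow> real \<Rightarrow> real \<Rightarrow> real \<Rightarrow> real \<Rightarrow> real \<times> real \<Rightarrow> real" where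
  "Wq s g c k \<tau> z = (g * gcos2 s (xr c \<tau> z)) * (xa c \<tau> * xb c \<tau>)
     + (1 * gcos2 s (yr c k \<tau> z)) * (ya c k \<tau> * yb c k \<tau>)"

definition Wr :: "real \<Rightarrow> real \<Rightarrow> real \<Rightarrow> real \<Rightarrow> real \<Rightarrow> real \<times> real \<Rightarrow> real" where
  "Wr s g c k \<tau> z = (g * gcos2 s (xr c \<tau> z)) * (xb c \<tau> * xb c \<tau>)
     + (1 * gcos2 s (yr c k \<tau> z)) * (yb c k \<tau> * yb c k \<tau>)"

lemma has_hess_Wf:
  assumes "0 < s"
  shows "has_hess (Wf s g c k \<tau>) (Wp s g c k \<tau>) (Wq s g c k \<tau>) (Wr s g c k \<tau>)"
  unfolding Wf_def Wp_def Wq_def Wr_def xr_def yr_def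
  using has_hess_ridge[OF DERIV_gcos[OF assms] DERIV_gcos1[OF assms] continuous_on_gcos2[OF assms]]
  by (intro has_hess_add)

lemma pucci_Wf_le:
  assumes s: "0 < s" and g: "0 \<le> g" and c: "0 < c" "k\<^sup>2 + c\<^sup>2 = 1"
    and lam: "0 < lam" "lam \<le> Lam" "Lam = s\<^sup>2 * lam"
    and b: "\<bar>xr c \<tau> z\<bar> \<le> pi / 2 + s * pi" "\<bar>yr c k \<tau> z\<bar> \<le> pi / 2 + s * pi"
  shows "pucci_plus lam Lam (Wp s g c k \<tau> z) (Wq s g c k \<tau> z) (Wr s g c k \<tau> z)
    \<le> - (lam / c\<^sup>2 * ((sig \<tau>)\<^sup>2 * (1 + \<tau>\<^sup>2))) * Wf s g c k \<tau> z"
proof -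
  note w1 = gcos_weight[OF s b(1) lam(1,3) g] and w2 = gcos_weight[OF s b(2) lam(1,3) zero_le_one]
  define N where "N = (sig \<tau>)\<^sup>2 * (1 + \<tau>\<^sup>2)"
  have "pucci_plus lam Lam (Wp s g c k \<tau> z) (Wq s g c k \<tau> z) (Wr s g c k \<tau> z)
      \<le> N / c\<^sup>2 * (- lam * (g * gcos s (xr c \<tau> z))) + N / c\<^sup>2 * (- lam * (1 * gcos s (yr c k \<tau> z)))"
    unfolding Wp_def Wq_def Wr_def
    by (rule order_trans[OF pucci_plus_subadd[OF lam(2)]])
      (simp only: pucci_plus_ridge coeff_norms[OF c] w1 w2 N_def order_refl)
  also have "\<dots> = - (lam / c\<^sup>2 * N) * Wf s g c k \<tau> z"
    by (simp add: Wf_def algebra_simps add_divide_distrib)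
  finally show ?thesis unfolding N_def .
qed

text \<open>Beyond the square one profile is negative, and the nonnegative sum forces the other to
  be positive. The Hessian is then a difference of two nonorthogonal ridges, where strictness holds.
  The entries are doubled because two copies coincide at \<tau> = 0.\<close>

lemma pucci_Wf_less:
  assumes s: "1 < s" and g: "0 < g" and c: "0 < c" "k\<^sup>2 + c\<^sup>2 = 1" and k: "k \<noteq> 0"
    and lam: "0 < lam" "Lam = s\<^sup>2 * lam"
    and L: "\<bar>xr c 0 z\<bar> \<le> Lstar s" "\<bar>yr c k 0 z\<bar> \<le> Lstar s" and U: "0 \<le> Wf s g c k 0 z"
    and out: "pi / 2 < \<bar>xr c 0 z\<bar> \<or> pi / 2 < \<bar>yr c k 0 z\<bar>"
  shows "pucci_plus lam Lam (Wp s g c k 0 z + Wp s g c k 0 z) (Wq s g c k 0 z + Wq s g c k 0 z)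
    (Wr s g c k 0 z + Wr s g c k 0 z) + lam / c\<^sup>2 * (Wf s g c k 0 z + Wf s g c k 0 z) < 0"
proof -
  define x where "x = xr c 0 z"
  define y where "y = yr c k 0 z"
  have lt: "lam < Lam" using s lam by (simp add: mult_less_cancel_right1)
  have s1: "1 \<le> s" and s0: "0 < s" using s by auto
  have neg: "gcos s t < 0" if "pi / 2 < \<bar>t\<bar>" "\<bar>t\<bar> \<le> Lstar s" for t
  proof -
    have "gcos s (pi / 2) = 0" by (simp add: gcos_def)
    then show ?thesis using gcos_less[of s "pi / 2" t] that s0 by (simp add: Lstar_def)
  qed
  have pos: "gcos2 s t = - gcos s t" if "0 < gcos s t" "\<bar>t\<bar> \<le> Lstar s" for t
    using gcos_pos_iff[OF s1, of t] that by (intro gcos2_inner) (simp add: Lstar_def)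
  have n1: "(1 / c)\<^sup>2 + 0\<^sup>2 = 1 / c\<^sup>2" by (simp add: power_divide)
  have "(k\<^sup>2 + c\<^sup>2) / c\<^sup>2 = 1 / c\<^sup>2" by (simp add: c)
  then have n2: "(- k / c)\<^sup>2 + 1\<^sup>2 = 1 / c\<^sup>2" using c(1) by (simp add: add_divide_distrib power_divide)
  have d: "1 / c * (- k / c) + 0 * 1 \<noteq> 0" "- k / c * (1 / c) + 1 * 0 \<noteq> 0" using c(1) k by simp_all
  have p: "0 < 1 / c\<^sup>2" using c(1) by simp
  have U': "0 \<le> g * gcos s x + gcos s y" using U by (simp add: Wf_def x_def y_def)
  have Lo: "Lam * (m * gcos2 s t) = - lam * (m * gcos s t)" if "pi / 2 < \<bar>t\<bar>" for m t
    using gcos2_outer[of s t] that s0 lam by (simp add: field_simps)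
  from out have "pi / 2 < \<bar>x\<bar> \<or> pi / 2 < \<bar>y\<bar>" by (simp add: x_def y_def)
  then show ?thesis
  proof
    assume x: "pi / 2 < \<bar>x\<bar>"
    have gx: "gcos s x < 0" using neg[OF x] L by (simp add: x_def)
    then have "g * gcos s x < 0" using g by (simp add: mult_pos_neg)
    then have gy: "0 < gcos s y" using U' by linarith
    have "0 < gcos2 s x" using gcos2_outer[of s x] x gx s0 by (simp add: divide_neg_pos)
    then have f1: "0 < 2 * g * gcos2 s x" using g by simp
    have f2: "0 < 2 * gcos s y" using gy by simp
    have y2: "gcos2 s y = - gcos s y" using pos[OF gy] L by (simp add: y_def)
    have "pucci_plus lam Lam (Wp s g c k 0 z + Wp s g c k 0 z) (Wq s g c k 0 z + Wq s g c k 0 z)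
        (Wr s g c k 0 z + Wr s g c k 0 z) < 1 / c\<^sup>2 * (Lam * (2 * g * gcos2 s x) - lam * (2 * gcos s y))"
      using pucci_plus_two_ridges_less[OF lt f1 f2 n1 n2 p d(1)]
      unfolding Wp_def Wq_def Wr_def x_def[symmetric] y_def[symmetric] y2 by (simp add: mult_ac)
    moreover have "1 / c\<^sup>2 * (Lam * (2 * g * gcos2 s x) - lam * (2 * gcos s y))
        = - (lam / c\<^sup>2 * (Wf s g c k 0 z + Wf s g c k 0 z))"
      unfolding Wf_def x_def[symmetric] y_def[symmetric] Lo[OF x]
      by (simp add: algebra_simps diff_divide_distrib add_divide_distrib)
    ultimately show ?thesis by linarith
  next
    assume y: "pi / 2 < \<bar>y\<bar>"
    have gy: "gcos s y < 0" using neg[OF y] L by (simp add: y_def)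
    then have "0 < g * gcos s x" using U' by linarith
    then have gx: "0 < gcos s x" using g by (simp add: zero_less_mult_iff)
    have f1: "0 < 2 * gcos2 s y" using gcos2_outer[of s y] y gy s0 by (simp add: divide_neg_pos)
    have f2: "0 < 2 * g * gcos s x" using gx g by simp
    have x2: "gcos2 s x = - gcos s x" using pos[OF gx] L by (simp add: x_def)
    have "pucci_plus lam Lam (Wp s g c k 0 z + Wp s g c k 0 z) (Wq s g c k 0 z + Wq s g c k 0 z)
        (Wr s g c k 0 z + Wr s g c k 0 z) < 1 / c\<^sup>2 * (Lam * (2 * gcos2 s y) - lam * (2 * g * gcos s x))"
      using pucci_plus_two_ridges_less[OF lt f1 f2 n2 n1 p d(2)]
      unfolding Wp_def Wq_def Wr_def x_def[symmetric] y_def[symmetric] x2 by (simp add: mult_ac)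
    moreover have "1 / c\<^sup>2 * (Lam * (2 * gcos2 s y) - lam * (2 * g * gcos s x))
        = - (lam / c\<^sup>2 * (Wf s g c k 0 z + Wf s g c k 0 z))"
      unfolding Wf_def x_def[symmetric] y_def[symmetric] Lo[OF y]
      by (simp add: algebra_simps diff_divide_distrib add_divide_distrib)
    ultimately show ?thesis by linarith
  qed
qed

lemma continuous_on_coeff [continuous_intros]:
  fixes f :: "'a::topological_space \<Rightarrow> real"
  assumes "0 < c" "continuous_on S f"
  shows "continuous_on S (\<lambda>w. xa c (f w))" "continuous_on S (\<lambda>w. xb c (f w))"
    "continuous_on S (\<lambda>w. ya c k (f w))" "continuous_on S (\<lambda>w. yb c k (f w))"
  unfolding xa_def xb_def ya_def yb_def using assms by (auto intro!: continuous_intros)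

lemma continuous_on_xr_yr [continuous_intros]:
  fixes f :: "'a::topological_space \<Rightarrow> real"
  assumes "0 < c" "continuous_on S f" "continuous_on S h"
  shows "continuous_on S (\<lambda>w. xr c (f w) (h w))" "continuous_on S (\<lambda>w. yr c k (f w) (h w))"
  unfolding xr_def yr_def using assms by (auto intro!: continuous_intros)

lemma continuous_on_W [continuous_intros]:
  fixes f :: "'a::topological_space \<Rightarrow> real"
  assumes "0 < s" "0 < c" "continuous_on S f" "continuous_on S h"
  shows "continuous_on S (\<lambda>w. Wf s g c k (f w) (h w))" "continuous_on S (\<lambda>w. Wp s g c k (f w) (h w))"
    "continuous_on S (\<lambda>w. Wq s g c k (f w) (h w))" "continuous_on S (\<lambda>w. Wr s g c k (f w) (h w))"
proof -
  note x = continuous_on_xr_yr(1)[OF assms(2-)] and y = continuous_on_xr_yr(2)[OF assms(2-), of k]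
  note [continuous_intros] =
    continuous_on_compose2[OF continuous_on_gcos[OF assms(1)] x subset_UNIV]
    continuous_on_compose2[OF continuous_on_gcos[OF assms(1)] y subset_UNIV]
    continuous_on_compose2[OF continuous_on_gcos2[OF assms(1)] x subset_UNIV]
    continuous_on_compose2[OF continuous_on_gcos2[OF assms(1)] y subset_UNIV]
  show "continuous_on S (\<lambda>w. Wf s g c k (f w) (h w))" "continuous_on S (\<lambda>w. Wp s g c k (f w) (h w))"
    "continuous_on S (\<lambda>w. Wq s g c k (f w) (h w))" "continuous_on S (\<lambda>w. Wr s g c k (f w) (h w))"
    unfolding Wf_def Wp_def Wq_def Wr_def by (intro continuous_intros assms)+
qed

lemma Wf_zero:
  assumes "c = sqrt (1 - (a / pi)\<^sup>2)"
  shows "xr c 0 z = fst (Cmap_inv a z)" "yr c (a / pi) 0 z = snd (Cmap_inv a z)"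
    "Wf s g c (a / pi) 0 z = Usum s g (Cmap_inv a z)"
proof -
  show x: "xr c 0 z = fst (Cmap_inv a z)" and y: "yr c (a / pi) 0 z = snd (Cmap_inv a z)"
    using Cmap_inv_ridge[OF assms, of z] by (simp_all add: xr_def yr_def)
  show "Wf s g c (a / pi) 0 z = Usum s g (Cmap_inv a z)"
    unfolding Wf_def Usum_def x y by simp
qed

text \<open>Averaging two slightly rotated and shrunk copies of the eigenfunction gains a factor
  \<open>(1 - \<tau>\<^sup>2/4)\<^sup>2 (1 + \<tau>\<^sup>2) > 1\<close> in the eigenvalue and keeps positivity at the four points where the
  boundary meets the corners of the square; elsewhere along the boundary positivity is restored by
  a bump supported where the eigenfunction is a strict supersolution.\<close>

definition vf where "vf s g c k b \<epsilon> \<tau> z = (Wf s g c k \<tau> z + Wf s g c k (- \<tau>) z)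
   + (\<epsilon> * bump b (xr c 0 z) + \<epsilon> * bump b (yr c k 0 z))"

definition vp where "vp s g c k b \<epsilon> \<tau> z = (Wp s g c k \<tau> z + Wp s g c k (- \<tau>) z)
   + ((\<epsilon> * bump2 b (xr c 0 z)) * (xa c 0 * xa c 0) + (\<epsilon> * bump2 b (yr c k 0 z)) * (ya c k 0 * ya c k 0))"

definition vq where "vq s g c k b \<epsilon> \<tau> z = (Wq s g c k \<tau> z + Wq s g c k (- \<tau>) z)
   + ((\<epsilon> * bump2 b (xr c 0 z)) * (xa c 0 * xb c 0) + (\<epsilon> * bump2 b (yr c k 0 z)) * (ya c k 0 * yb c k 0))"

definition vr where "vr s g c k b \<epsilon> \<tau> z = (Wr s g c k \<tau> z + Wr s g c k (- \<tau>) z)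
   + ((\<epsilon> * bump2 b (xr c 0 z)) * (xb c 0 * xb c 0) + (\<epsilon> * bump2 b (yr c k 0 z)) * (yb c k 0 * yb c k 0))"

lemma has_hess_vf:
  assumes "0 < s"
  shows "has_hess (vf s g c k b \<epsilon> \<tau>) (vp s g c k b \<epsilon> \<tau>) (vq s g c k b \<epsilon> \<tau>) (vr s g c k b \<epsilon> \<tau>)"
  unfolding vf_def vp_def vq_def vr_def xr_def yr_def
  by (intro has_hess_add has_hess_Wf[OF assms] has_hess_ridge[OF DERIV_bump DERIV_bump1 continuous_on_bump2])

lemma continuous_on_v [continuous_intros]:
  fixes f f' :: "'a::topological_space \<Rightarrow> real"
  assumes "0 < s" "0 < c" "continuous_on S f" "continuous_on S f'" "continuous_on S h"
  shows "continuous_on S (\<lambda>w. vf s g c k b (f w) (f' w) (h w))"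
    "continuous_on S (\<lambda>w. vp s g c k b (f w) (f' w) (h w))"
    "continuous_on S (\<lambda>w. vq s g c k b (f w) (f' w) (h w))"
    "continuous_on S (\<lambda>w. vr s g c k b (f w) (f' w) (h w))"
proof -
  note x = continuous_on_xr_yr(1)[OF assms(2) continuous_on_const assms(5), of 0]
    and y = continuous_on_xr_yr(2)[OF assms(2) continuous_on_const assms(5), of k 0]
  note [continuous_intros] =
    continuous_on_compose2[OF continuous_on_bump x subset_UNIV]
    continuous_on_compose2[OF continuous_on_bump y subset_UNIV]
    continuous_on_compose2[OF continuous_on_bump2 x subset_UNIV]
    continuous_on_compose2[OF continuous_on_bump2 y subset_UNIV]
  show "continuous_on S (\<lambda>w. vf s g c k b (f w) (f' w) (h w))"
    "continuous_on S (\<lambda>w. vp s g c k b (f w) (f' w) (h w))"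
    "continuous_on S (\<lambda>w. vq s g c k b (f w) (f' w) (h w))"
    "continuous_on S (\<lambda>w. vr s g c k b (f w) (f' w) (h w))"
    unfolding vf_def vp_def vq_def vr_def by (intro continuous_intros assms)+
qed

text \<open>The tube lemma makes one threshold on the parameter serve the whole compact set, which
  preserves strictness under the perturbation.\<close>

lemma negative_near_zero:
  fixes G :: "real \<Rightarrow> 'b::topological_space \<Rightarrow> real"
  assumes "compact K" "continuous_on UNIV (\<lambda>w. G (fst w) (snd w))" "\<And>z. z \<in> K \<Longrightarrow> G 0 z < 0"
  shows "\<exists>e>0. \<forall>\<epsilon>. \<bar>\<epsilon>\<bar> < e \<longrightarrow> (\<forall>z\<in>K. G \<epsilon> z < 0)"
proof -
  have o: "open {w. G (fst w) (snd w) < 0}" by (intro open_Collect_less assms(2) continuous_intros)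
  have sub: "{0} \<times> K \<subseteq> {w. G (fst w) (snd w) < 0}" using assms(3) by auto
  obtain X where X: "0 \<in> X" "open X" "X \<times> K \<subseteq> {w. G (fst w) (snd w) < 0}"
    using Elementary_Topology.tube_lemma[OF assms(1) o sub] by blast
  then obtain e where e: "0 < e" "ball 0 e \<subseteq> X" using openE by blast
  show ?thesis
  proof (intro exI[of _ e] conjI allI impI ballI)
    fix \<epsilon> z assume "\<bar>\<epsilon>\<bar> < e" "z \<in> K"
    then have "(\<epsilon>, z) \<in> X \<times> K" using e(2) by (auto simp: subset_eq dist_real_def)
    then show "G \<epsilon> z < 0" using X(3) by auto
  qed (rule e)
qed

lemma rotated_bounds:
  assumes \<tau>: "\<bar>\<tau>\<bar> \<le> 1" and b: "\<bar>x\<bar> \<le> L" "\<bar>h\<bar> \<le> H"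
  shows "\<bar>sig \<tau> * (x + \<tau> * h)\<bar> \<le> L + \<bar>\<tau>\<bar> * H" "\<bar>sig \<tau> * (x + \<tau> * h) - x\<bar> \<le> \<bar>\<tau>\<bar> * (L + 2 * H)"
proof -
  have t2: "\<tau>\<^sup>2 \<le> \<bar>\<tau>\<bar>" using mult_right_mono[OF \<tau>, of "\<bar>\<tau>\<bar>"] by (simp add: power2_eq_square abs_mult_self_eq)
  have s: "0 \<le> sig \<tau>" "sig \<tau> \<le> 1" using t2 \<tau> by (simp_all add: sig_def)
  have th: "\<bar>\<tau> * h\<bar> \<le> \<bar>\<tau>\<bar> * H" using b(2) by (simp add: abs_mult mult_left_mono)
  have LH: "0 \<le> L" "0 \<le> H" using b by linarith+
  have xh: "\<bar>x + \<tau> * h\<bar> \<le> L + \<bar>\<tau>\<bar> * H" using b th by linarith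
  have "\<bar>sig \<tau> * (x + \<tau> * h)\<bar> \<le> 1 * \<bar>x + \<tau> * h\<bar>"
    unfolding abs_mult[of "sig \<tau>"] using s by (intro mult_right_mono) auto
  also have "\<dots> \<le> L + \<bar>\<tau>\<bar> * H" using xh by simp
  finally show "\<bar>sig \<tau> * (x + \<tau> * h)\<bar> \<le> L + \<bar>\<tau>\<bar> * H" .
  have "\<bar>\<tau>\<bar> * H \<le> 1 * H" using \<tau> LH by (intro mult_right_mono)
  then have xh': "\<bar>x + \<tau> * h\<bar> \<le> L + H" using xh by linarith
  have "sig \<tau> * (x + \<tau> * h) - x = \<tau> * h - \<tau>\<^sup>2 / 4 * (x + \<tau> * h)"
    by (simp add: sig_def algebra_simps)
  moreover have "\<bar>\<tau>\<^sup>2 / 4 * (x + \<tau> * h)\<bar> \<le> \<bar>\<tau>\<bar> * (L + H)"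
    unfolding abs_mult[of "\<tau>\<^sup>2 / 4"] using t2 xh' LH by (intro mult_mono) auto
  ultimately show "\<bar>sig \<tau> * (x + \<tau> * h) - x\<bar> \<le> \<bar>\<tau>\<bar> * (L + 2 * H)"
    using th abs_triangle_ineq4[of "\<tau> * h" "\<tau>\<^sup>2 / 4 * (x + \<tau> * h)"]
      distrib_left[of "\<bar>\<tau>\<bar>" "L + H" H] by (simp only: add.assoc mult_2)
qed

lemma Wf_close:
  assumes s: "0 < s" and g: "0 \<le> g" and c: "0 < c" "k\<^sup>2 + c\<^sup>2 = 1" and \<tau>: "\<bar>\<tau>\<bar> \<le> 1"
    and L: "\<bar>xr c 0 z\<bar> \<le> L" "\<bar>yr c k 0 z\<bar> \<le> L" and H: "2 * L / c \<le> H"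
  shows "Wf s g c k 0 z - (g + 1) * (\<bar>\<tau>\<bar> * (L + 2 * H)) \<le> Wf s g c k \<tau> z"
proof -
  have h: "\<bar>xh c z\<bar> \<le> H" "\<bar>yh c k z\<bar> \<le> H" using abs_xh_yh_le[OF c L] H by linarith+
  have "\<bar>gcos s (xr c \<tau> z) - gcos s (xr c 0 z)\<bar> \<le> \<bar>\<tau>\<bar> * (L + 2 * H)"
    unfolding xr_eq[of c \<tau> z]
    by (rule order_trans[OF gcos_lipschitz[OF s] rotated_bounds(2)[OF \<tau> L(1) h(1)]])
  then have "g * \<bar>gcos s (xr c \<tau> z) - gcos s (xr c 0 z)\<bar> \<le> g * (\<bar>\<tau>\<bar> * (L + 2 * H))"
    using g by (intro mult_left_mono)
  then have 1: "g * gcos s (xr c 0 z) - g * (\<bar>\<tau>\<bar> * (L + 2 * H)) \<le> g * gcos s (xr c \<tau> z)"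
    using mult_left_mono[OF abs_ge_minus_self[of "gcos s (xr c \<tau> z) - gcos s (xr c 0 z)"] g]
    by (simp add: algebra_simps)
  have 2: "\<bar>gcos s (yr c k \<tau> z) - gcos s (yr c k 0 z)\<bar> \<le> \<bar>\<tau>\<bar> * (L + 2 * H)"
    unfolding yr_eq[of c k \<tau> z]
    by (rule order_trans[OF gcos_lipschitz[OF s] rotated_bounds(2)[OF \<tau> L(2) h(2)]])
  have "(g + 1) * (\<bar>\<tau>\<bar> * (L + 2 * H)) = g * (\<bar>\<tau>\<bar> * (L + 2 * H)) + \<bar>\<tau>\<bar> * (L + 2 * H)"
    by (simp add: algebra_simps)
  then show ?thesis using 1 2 unfolding Wf_def by linarith
qed

text \<open>A shrinking 1 - m \<tau>^2 changes the factor by about (1 - 2m) \<tau>^2, while the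
  corner estimate wants m > 0. The coefficient m = 1/4 lies midway in the admissible range 0 < m <
  1/2.\<close>

lemma sig_gain:
  assumes "0 < \<tau>" "\<tau> \<le> 1 / 2"
  shows "1 < (sig \<tau>)\<^sup>2 * (1 + \<tau>\<^sup>2)"
proof -
  define q where "q = \<tau>\<^sup>2"
  have q: "0 < q" "q \<le> 1 / 4"
    using assms power_mono[of \<tau> "1 / 2" 2] by (auto simp: q_def power2_eq_square)
  have "(sig \<tau>)\<^sup>2 * (1 + \<tau>\<^sup>2) = 1 + q * (1 / 2 - 7 / 16 * q + q * q / 16)"
    unfolding sig_def q_def[symmetric] by (simp add: power2_eq_square field_simps)
  moreover have "0 < q * (1 / 2 - 7 / 16 * q + q * q / 16)"
    using q by (intro mult_pos_pos add_pos_nonneg) auto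
  ultimately show ?thesis by linarith
qed

text \<open>One term is at least sin \<delta> times its weight, the other at worst slightly
  negative; \<eta> is half of sin \<delta>/s so that a remainder of \<eta> survives for every
  admissible \<open>g\<close>.\<close>

lemma Wf_ge_off_corners:
  assumes s: "1 \<le> s" and g: "1 / s \<le> g" "g \<le> s" and \<delta>: "0 \<le> \<delta>" "\<delta> \<le> 1"
    and \<eta>: "\<eta> = sin \<delta> / (2 * s)"
    and L: "\<bar>xr c 0 z\<bar> \<le> pi / 2 + \<eta>" "\<bar>yr c k 0 z\<bar> \<le> pi / 2 + \<eta>"
    and off: "\<bar>xr c 0 z\<bar> \<le> pi / 2 - \<delta> \<or> \<bar>yr c k 0 z\<bar> \<le> pi / 2 - \<delta>"
  shows "\<eta> \<le> Wf s g c k 0 z"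
proof -
  have g0: "0 < g" using g s less_le_trans[of 0 "1 / s" g] by simp
  have sd: "0 \<le> sin \<delta>" using \<delta> pi_gt3 by (intro sin_ge_zero) auto
  have \<eta>0: "0 \<le> \<eta>" using sd s by (simp add: \<eta>)
  have s\<eta>: "s * \<eta> = sin \<delta> / 2" using s by (simp add: \<eta>)
  have low: "- \<eta> \<le> gcos s t" if "\<bar>t\<bar> \<le> pi / 2 + \<eta>" for t
  proof (cases "pi / 2 \<le> \<bar>t\<bar>")
    case True
    then show ?thesis using gcos_ge[OF s True] that by linarith
  next
    case False
    then have "0 \<le> cos t" by (intro cos_ge_zero) auto
    then show ?thesis using False \<eta>0 by (simp add: gcos_def)
  qed
  from off show ?thesis
  proof
    assume x: "\<bar>xr c 0 z\<bar> \<le> pi / 2 - \<delta>"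
    have "1 / s * sin \<delta> \<le> g * gcos s (xr c 0 z)"
      using gcos_ge_sin[OF \<delta>(1) x] g g0 sd by (intro mult_mono) auto
    moreover have "1 / s * sin \<delta> = 2 * \<eta>" using s by (simp add: \<eta>)
    ultimately show ?thesis using low[OF L(2)] unfolding Wf_def by linarith
  next
    assume y: "\<bar>yr c k 0 z\<bar> \<le> pi / 2 - \<delta>"
    have "g * (- \<eta>) \<le> g * gcos s (xr c 0 z)" using low[OF L(1)] g0 by (intro mult_left_mono) auto
    moreover have "g * \<eta> \<le> s * \<eta>" using g \<eta>0 by (intro mult_right_mono)
    moreover have "1 * \<eta> \<le> s * \<eta>" using s \<eta>0 by (intro mult_right_mono)
    ultimately show ?thesis using gcos_ge_sin[OF \<delta>(1) y, of s] s\<eta> unfolding Wf_def by linarith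
  qed
qed

lemma Wf_corner:
  assumes s: "1 \<le> s" and g: "0 \<le> g" and c: "0 < c" "k\<^sup>2 + c\<^sup>2 = 1"
    and L: "\<bar>xr c 0 z\<bar> \<le> L" "\<bar>yr c k 0 z\<bar> \<le> L" and H: "2 * L / c \<le> H" "1 \<le> H"
    and \<delta>: "0 < \<delta>" "64 * H\<^sup>2 * \<delta> \<le> 1" and \<tau>: "0 < \<tau>" "4 * H * \<tau> \<le> \<delta>"
    and t: "\<bar>\<bar>xr c 0 z\<bar> - pi / 2\<bar> \<le> \<delta>" "\<bar>\<bar>yr c k 0 z\<bar> - pi / 2\<bar> \<le> \<delta>"
  shows "2 * Wf s g c k 0 z \<le> Wf s g c k \<tau> z + Wf s g c k (- \<tau>) z"
proof -
  have h: "\<bar>xh c z\<bar> \<le> H" "\<bar>yh c k z\<bar> \<le> H" using abs_xh_yh_le[OF c L] H by linarith+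
  have "2 * gcos s (xr c 0 z) \<le> gcos s (xr c \<tau> z) + gcos s (xr c (- \<tau>) z)"
    using gcos_corner[OF s H(2) h(1) \<delta> \<tau> t(1) sig_def] xr_eq[of c \<tau> z] xr_eq[of c "- \<tau>" z] by simp
  from mult_left_mono[OF this g]
  have "2 * (g * gcos s (xr c 0 z)) \<le> g * gcos s (xr c \<tau> z) + g * gcos s (xr c (- \<tau>) z)"
    by (simp add: algebra_simps)
  moreover have "2 * gcos s (yr c k 0 z) \<le> gcos s (yr c k \<tau> z) + gcos s (yr c k (- \<tau>) z)"
    using gcos_corner[OF s H(2) h(2) \<delta> \<tau> t(2) sig_def] yr_eq[of c k \<tau> z] yr_eq[of c k "- \<tau>" z] by simp
  ultimately show ?thesis unfolding Wf_def by (simp add: distrib_left)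
qed

lemma strict_supersol:
  assumes s: "1 < s" and g: "1 / s \<le> g" "g \<le> s" and a: "\<bar>a\<bar> < pi" "a \<noteq> 0"
    and cdef: "c = sqrt (1 - (a / pi)\<^sup>2)" and lam: "0 < lam" "Lam = s\<^sup>2 * lam"
  shows "\<exists>mu phi. lam / c\<^sup>2 < mu \<and> continuous_on (Omega_star s g a) phi \<and>
    (\<forall>z\<in>Omega_star s g a. 0 < phi z) \<and> visc_supersol lam Lam mu (Omega_star s g a) phi"
proof -
  define k where "k = a / pi"
  have s1: "1 \<le> s" and s0: "0 < s" using s by auto
  have g0: "0 < g" using g s less_le_trans[of 0 "1 / s" g] by simp
  have c: "0 < c" "k\<^sup>2 + c\<^sup>2 = 1" using ridge_norms[OF a(1) cdef] by (auto simp: k_def)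
  have k0: "k \<noteq> 0" using a by (simp add: k_def)
  have lamL: "lam \<le> Lam" using s lam by (simp add: mult_le_cancel_right1)
  note z0 = Wf_zero[OF cdef, folded k_def]
  define L where "L = Lstar s"
  have L0: "0 < L" using s0 by (simp add: L_def Lstar_def add_pos_pos)
  define H where "H = 2 * L / c + 1"
  have H: "2 * L / c \<le> H" "1 \<le> H" using L0 c by (auto simp: H_def)
  define \<delta> where "\<delta> = 1 / (64 * H\<^sup>2)"
  have H2: "1 \<le> H\<^sup>2" using H by (simp add: one_le_power)
  have \<delta>: "0 < \<delta>" "64 * H\<^sup>2 * \<delta> \<le> 1" "\<delta> \<le> 1"
    using H2 by (auto simp: \<delta>_def divide_le_eq_1)
  define \<eta> where "\<eta> = sin \<delta> / (2 * s)"
  have sd: "0 < sin \<delta>" using \<delta> pi_gt3 by (intro sin_gt_zero) auto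
  have sd2: "sin \<delta> \<le> \<delta>" using \<delta> by (intro sin_x_le_x) auto
  have \<eta>: "0 < \<eta>" using sd s0 by (simp add: \<eta>_def)
  have "sin \<delta> / (2 * s) \<le> sin \<delta> / 1" using sd s by (intro divide_left_mono) auto
  then have \<eta>\<delta>: "\<eta> \<le> \<delta>" using sd2 by (simp add: \<eta>_def)
  \<comment> \<open>Halfway to pi/2 + \<eta>: the bump lives strictly outside the square, where
    strictness is available, and is at least \<open>d\<close> once a coordinate passes pi/2 +
    \<eta>.\<close>
  define b where "b = pi / 2 + \<eta> / 2"
  define C where "C = (g + 1) * (L + 2 * H)"
  have C: "0 < C" using g0 L0 H by (simp add: C_def add_pos_pos)
  define d where "d = (\<eta> / 2) ^ 3"
  have d: "0 < d" using \<eta> by (simp add: d_def)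
  \<comment> \<open>With \<tau> = \<kappa> \<epsilon> each rotated copy loses at most d
    \<epsilon>/4, together half of what the bump provides.\<close>
  define \<kappa> where "\<kappa> = d / (4 * C)"
  have \<kappa>: "0 < \<kappa>" using d C by (simp add: \<kappa>_def)
  have \<kappa>C: "C * \<kappa> = d / 4" using C by (simp add: \<kappa>_def)
  define N where "N = (\<lambda>\<tau>. lam / c\<^sup>2 * ((sig \<tau>)\<^sup>2 * (1 + \<tau>\<^sup>2)))"
  \<comment> \<open>Bump and rotation are tied to one parameter, so a single perturbation argument
    starting from the doubled eigenfunction at \<epsilon> = 0 treats both.\<close>
  define G where "G = (\<lambda>\<epsilon> z. pucci_plus lam Lam (vp s g c k b \<epsilon> (\<kappa> * \<epsilon>) z) (vq s g c k b \<epsilon> (\<kappa> * \<epsilon>) z)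
      (vr s g c k b \<epsilon> (\<kappa> * \<epsilon>) z) + N (\<kappa> * \<epsilon>) * vf s g c k b \<epsilon> (\<kappa> * \<epsilon>) z)"
  define K where "K = Omega_star_closed s g a \<inter> {z. b \<le> \<bar>xr c 0 z\<bar> \<or> b \<le> \<bar>yr c k 0 z\<bar>}"
  have "closed {z. b \<le> \<bar>xr c 0 z\<bar> \<or> b \<le> \<bar>yr c k 0 z\<bar>}"
    by (intro closed_Collect_disj closed_Collect_le continuous_intros c(1))
  then have "compact K" unfolding K_def
    by (intro compact_Int_closed compact_Omega_star_closed s0 a(1))
  moreover have "continuous_on UNIV (\<lambda>w. G (fst w) (snd w))"
    unfolding G_def N_def by (intro continuous_intros s0 c(1))
  moreover have "G 0 z < 0" if z: "z \<in> K" for z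
  proof -
    have "pucci_plus lam Lam (Wp s g c k 0 z + Wp s g c k 0 z) (Wq s g c k 0 z + Wq s g c k 0 z)
        (Wr s g c k 0 z + Wr s g c k 0 z) + lam / c\<^sup>2 * (Wf s g c k 0 z + Wf s g c k 0 z) < 0"
      by (rule pucci_Wf_less[OF s g0 c k0 lam])
        (use z \<eta> in \<open>auto simp: K_def Omega_star_closed_def z0 b_def\<close>)
    then show ?thesis by (simp add: G_def N_def vp_def vq_def vr_def vf_def)
  qed
  ultimately obtain e where e: "0 < e" "\<And>\<epsilon> z. \<bar>\<epsilon>\<bar> < e \<Longrightarrow> z \<in> K \<Longrightarrow> G \<epsilon> z < 0"
    using negative_near_zero[of K G] by blast
  \<comment> \<open>In order, the entries give strictness on \<open>K\<close>, smallness for the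
    corner estimate, \<tau> \<le> 1/2, validity of the weight identity at rotated points, and a loss
    at most \<eta>/2 inside.\<close>
  define \<epsilon> where "\<epsilon> = Min {e / 2, \<delta> / (4 * H * \<kappa>), 1 / (2 * \<kappa>), s / (H * \<kappa>), \<eta> / d}"
  have "0 < \<epsilon>" using e \<delta> H \<kappa> \<eta> d s0 by (simp add: \<epsilon>_def)
  have \<epsilon>: "\<epsilon> \<le> e / 2" "\<epsilon> \<le> \<delta> / (4 * H * \<kappa>)" "\<epsilon> \<le> 1 / (2 * \<kappa>)" "\<epsilon> \<le> s / (H * \<kappa>)" "\<epsilon> \<le> \<eta> / d"
    unfolding \<epsilon>_def by (rule Min_le; simp)+
  define \<tau> where "\<tau> = \<kappa> * \<epsilon>"
  have \<tau>0: "0 < \<tau>" using \<kappa> \<open>0 < \<epsilon>\<close> by (simp add: \<tau>_def)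
  have \<tau>H: "4 * H * \<tau> \<le> \<delta>" using \<epsilon>(2) H \<kappa> by (simp add: \<tau>_def field_simps)
  have \<tau>1: "\<tau> \<le> 1 / 2" using \<epsilon>(3) \<kappa> by (simp add: \<tau>_def field_simps)
  have \<tau>s: "\<tau> * H \<le> s" using \<epsilon>(4) H \<kappa> by (simp add: \<tau>_def field_simps)
  have d\<epsilon>: "d * \<epsilon> \<le> \<eta>" using \<epsilon>(5) d by (simp add: field_simps)
  have C\<tau>: "C * \<tau> = d * \<epsilon> / 4" using \<kappa>C by (simp add: \<tau>_def)
  have bnd: "\<bar>xr c 0 z\<bar> \<le> L" "\<bar>yr c k 0 z\<bar> \<le> L" if "z \<in> Omega_star s g a" for z
    using that by (auto simp: Omega_star_def z0 L_def)
  have pos: "0 < vf s g c k b \<epsilon> \<tau> z" if z: "z \<in> Omega_star s g a" for z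
  proof -
    have U: "0 < Wf s g c k 0 z" using z by (simp add: Omega_star_def z0)
    have close: "Wf s g c k 0 z - d * \<epsilon> / 4 \<le> Wf s g c k \<tau>' z" if "\<bar>\<tau>'\<bar> = \<tau>" for \<tau>'
    proof -
      have "(g + 1) * (\<bar>\<tau>'\<bar> * (L + 2 * H)) = C * \<tau>" by (simp add: that C_def)
      then show ?thesis
        using Wf_close[OF s0 less_imp_le[OF g0] c _ bnd[OF z] H(1), of \<tau>'] that \<tau>1 C\<tau> by simp
    qed
    have close2: "2 * Wf s g c k 0 z - d * \<epsilon> / 2 \<le> Wf s g c k \<tau> z + Wf s g c k (- \<tau>) z"
      using close[of \<tau>] close[of "- \<tau>"] \<tau>0 by simp
    have bn: "0 \<le> \<epsilon> * bump b t" for t using \<open>0 < \<epsilon>\<close> by (simp add: bump_nonneg)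
    have de: "0 < d * \<epsilon>" using d \<open>0 < \<epsilon>\<close> by simp
    \<comment> \<open>The three zones obtain positivity from the bump, from the size of the
      eigenfunction, and from the averaging at a corner; \<eta> \<le> \<delta> makes them
      exhaustive.\<close>
    consider "pi / 2 + \<eta> \<le> \<bar>xr c 0 z\<bar> \<or> pi / 2 + \<eta> \<le> \<bar>yr c k 0 z\<bar>"
      | "\<bar>xr c 0 z\<bar> \<le> pi / 2 + \<eta>" "\<bar>yr c k 0 z\<bar> \<le> pi / 2 + \<eta>"
        "\<bar>xr c 0 z\<bar> \<le> pi / 2 - \<delta> \<or> \<bar>yr c k 0 z\<bar> \<le> pi / 2 - \<delta>"
      | "\<bar>\<bar>xr c 0 z\<bar> - pi / 2\<bar> \<le> \<delta>" "\<bar>\<bar>yr c k 0 z\<bar> - pi / 2\<bar> \<le> \<delta>"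
      using \<eta>\<delta> by linarith
    then show ?thesis
    proof cases
      case 1
      have bg: "d * \<epsilon> \<le> \<epsilon> * bump b t" if "pi / 2 + \<eta> \<le> \<bar>t\<bar>" for t
        using bump_ge[of "\<eta> / 2" b t] that \<eta> \<open>0 < \<epsilon>\<close> by (simp add: b_def d_def)
      have "d * \<epsilon> \<le> \<epsilon> * bump b (xr c 0 z) + \<epsilon> * bump b (yr c k 0 z)"
        using 1 bg[of "xr c 0 z"] bg[of "yr c k 0 z"] bn[of "xr c 0 z"] bn[of "yr c k 0 z"] by linarith
      then show ?thesis unfolding vf_def using close2 U de by linarith
    next
      case 2
      have "\<eta> \<le> Wf s g c k 0 z"
        by (rule Wf_ge_off_corners[OF s1 g less_imp_le[OF \<delta>(1)] \<delta>(3) \<eta>_def 2])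
      then show ?thesis
        unfolding vf_def using close2 bn[of "xr c 0 z"] bn[of "yr c k 0 z"] d\<epsilon> \<eta> by linarith
    next
      case 3
      have "2 * Wf s g c k 0 z \<le> Wf s g c k \<tau> z + Wf s g c k (- \<tau>) z"
        by (rule Wf_corner[OF s1 less_imp_le[OF g0] c bnd[OF z] H \<delta>(1,2) \<tau>0 \<tau>H 3])
      then show ?thesis unfolding vf_def using bn[of "xr c 0 z"] bn[of "yr c k 0 z"] U by linarith
    qed
  qed
  have pde: "pucci_plus lam Lam (vp s g c k b \<epsilon> \<tau> z) (vq s g c k b \<epsilon> \<tau> z) (vr s g c k b \<epsilon> \<tau> z)
      + N \<tau> * vf s g c k b \<epsilon> \<tau> z \<le> 0" if z: "z \<in> Omega_star s g a" for z
  proof (cases "z \<in> K")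
    case True
    then have "G \<epsilon> z < 0" using e \<epsilon>(1) \<open>0 < \<epsilon>\<close> by (intro e(2)) auto
    then show ?thesis by (simp add: G_def \<tau>_def)
  next
    case False
    then have "\<bar>xr c 0 z\<bar> \<le> b" "\<bar>yr c k 0 z\<bar> \<le> b"
      using z Omega_star_subset by (auto simp: K_def)
    \<comment> \<open>Off \<open>K\<close> the bumps and their second derivatives vanish, so only
      the two rotated copies remain, and each satisfies the inequality with the improved
      constant.\<close>
    note b0 = bump_zero[OF this(1)] bump_zero[OF this(2)]
    have h: "\<bar>xh c z\<bar> \<le> H" "\<bar>yh c k z\<bar> \<le> H" using abs_xh_yh_le[OF c bnd[OF z]] H by linarith+
    have far: "L + \<tau> * H \<le> pi / 2 + s * pi"
    proof -
      have "s * 1 \<le> s * (pi / 2)" using s0 pi_gt3 by (intro mult_left_mono) auto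
      moreover have "s * pi = s * (pi / 2) + s * (pi / 2)" by simp
      ultimately show ?thesis using \<tau>s unfolding L_def Lstar_def by linarith
    qed
    have one: "pucci_plus lam Lam (Wp s g c k \<tau>' z) (Wq s g c k \<tau>' z) (Wr s g c k \<tau>' z)
        \<le> - N \<tau>' * Wf s g c k \<tau>' z" if t: "\<bar>\<tau>'\<bar> = \<tau>" for \<tau>'
    proof -
      have 1: "\<bar>\<tau>'\<bar> \<le> 1" using t \<tau>1 by simp
      have "\<bar>xr c \<tau>' z\<bar> \<le> pi / 2 + s * pi"
        using rotated_bounds(1)[OF 1 bnd(1)[OF z] h(1)] far unfolding xr_eq[of c \<tau>' z] t by linarith
      moreover have "\<bar>yr c k \<tau>' z\<bar> \<le> pi / 2 + s * pi"
        using rotated_bounds(1)[OF 1 bnd(2)[OF z] h(2)] far unfolding yr_eq[of c k \<tau>' z] t by linarith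
      ultimately show ?thesis
        unfolding N_def by (rule pucci_Wf_le[OF s0 less_imp_le[OF g0] c lam(1) lamL lam(2)])
    qed
    have "N (- \<tau>) = N \<tau>" by (simp add: N_def)
    moreover have "pucci_plus lam Lam (Wp s g c k \<tau> z + Wp s g c k (- \<tau>) z)
        (Wq s g c k \<tau> z + Wq s g c k (- \<tau>) z) (Wr s g c k \<tau> z + Wr s g c k (- \<tau>) z)
        \<le> - N \<tau> * Wf s g c k \<tau> z + - N (- \<tau>) * Wf s g c k (- \<tau>) z"
      using one[of \<tau>] one[of "- \<tau>"] \<tau>0
      by (intro order_trans[OF pucci_plus_subadd[OF lamL]] add_mono) auto
    ultimately show ?thesis
      unfolding vp_def vq_def vr_def vf_def using b0 by (simp add: algebra_simps)
  qed
  have cont: "continuous_on (Omega_star s g a) (vf s g c k b \<epsilon> \<tau>)"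
    by (rule continuous_on_v(1)[OF s0 c(1) continuous_on_const continuous_on_const continuous_on_id])
  have super: "visc_supersol lam Lam (N \<tau>) (Omega_star s g a) (vf s g c k b \<epsilon> \<tau>)"
    using lam(1) lamL pde
    by (intro visc_supersol_classical[OF _ _ open_Omega_star[OF s0 a(1)] has_hess_vf[OF s0] refl]) auto
  have "lam / c\<^sup>2 * 1 < N \<tau>"
    unfolding N_def using sig_gain[OF \<tau>0 \<tau>1] lam c by (intro mult_strict_left_mono) auto
  then have "lam / c\<^sup>2 < N \<tau>" by simp
  then show ?thesis using cont super pos by blast
qed

section \<open>Supersolution property, eigenvalue bound and the equality case\<close>

theorem theorem2p3:
  fixes lam Lam w g a :: real
  assumes "0 < lam" and "lam \<le> Lam"
    and "w = Lam / lam"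
    and "1 / sqrt w \<le> g" and "g \<le> sqrt w"
    and "\<bar>a\<bar> < pi"
  shows "visc_supersol lam Lam (lam * pi\<^sup>2 / (pi\<^sup>2 - a\<^sup>2)) (Omega_wga w g a) (u_wga w g a)
    \<and> (\<forall>z\<in>Omega_wga w g a. u_wga w g a z > 0)
    \<and> (\<forall>z\<in>frontier (Omega_wga w g a). u_wga w g a z = 0)
    \<and> ereal (lam * pi\<^sup>2 / (pi\<^sup>2 - a\<^sup>2)) \<le> principal_eig lam Lam (Omega_wga w g a)
    \<and> (principal_eig lam Lam (Omega_wga w g a) = ereal (lam * pi\<^sup>2 / (pi\<^sup>2 - a\<^sup>2))
         \<longleftrightarrow> (w = 1 \<or> a = 0))"
proof -
  define s where "s = sqrt w"
  define c where "c = sqrt (1 - (a / pi)\<^sup>2)"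
  define mu0 where "mu0 = lam / c\<^sup>2"
  have mu0: "lam * pi\<^sup>2 / (pi\<^sup>2 - a\<^sup>2) = mu0"
    using arg_cong[OF ridge_norms(2)[OF assms(6) c_def], of "(*) lam"] by (simp add: mu0_def)
  have w1: "1 \<le> w" using assms(1-3) by simp
  have s1: "1 \<le> s" and s0: "0 < s" using w1 by (auto simp: s_def)
  have Lam: "Lam = s\<^sup>2 * lam" using w1 assms(1,3) by (simp add: s_def)
  have g: "1 / s \<le> g" "g \<le> s" using assms(4,5) by (auto simp: s_def)
  have g0: "0 < g" using g s1 less_le_trans[of 0 "1 / s" g] by simp
  define \<Omega> where "\<Omega> = Omega_star s g a"
  have \<Omega>: "Omega_wga w g a = \<Omega>" unfolding \<Omega>_def by (rule Omega_wga_eq[OF s1 s_def g assms(6)])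
  have op: "open \<Omega>" unfolding \<Omega>_def by (rule open_Omega_star[OF s0 assms(6)])
  \<comment> \<open>The trivial factors make this the instance \<kappa> = \<theta> = 1 of the
    Hessian formula for scaled eigenfunctions.\<close>
  define U where "U = (\<lambda>z. 1 * Usum s g (Cmap_inv a (1 *\<^sub>R z)))"
  have u: "u_wga w g a z = U z" if "z \<in> Omega_star_closed s g a" for z
    using that u_wg_eq[OF s1 s_def g0, of "Cmap_inv a z"] by (simp add: u_wga_def U_def Omega_star_closed_def)
  have sub: "\<Omega> \<subseteq> Omega_star_closed s g a" unfolding \<Omega>_def by (rule Omega_star_subset)
  have pos: "0 < u_wga w g a z" if "z \<in> \<Omega>" for z
    using that u[of z] sub by (auto simp: U_def \<Omega>_def Omega_star_def)
  have super: "visc_supersol lam Lam mu0 \<Omega> (u_wga w g a)"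
  proof (rule visc_supersol_classical[OF _ assms(2) op has_hess_Usum[OF s0 c_def, of 1 g 1]])
    fix z assume "z \<in> \<Omega>"
    then have z: "z \<in> Omega_star_closed s g a" using sub by blast
    show "u_wga w g a z = 1 * Usum s g (Cmap_inv a (1 *\<^sub>R z))" using u[OF z] by (simp add: U_def)
    show "pucci_plus lam Lam
        (1 * g * gcos2 s (fst (Cmap_inv a (1 *\<^sub>R z))) * (1 / c * (1 / c)) +
         1 * gcos2 s (snd (Cmap_inv a (1 *\<^sub>R z))) * (- (a / pi) * 1 / c * (- (a / pi) * 1 / c)))
        (1 * g * gcos2 s (fst (Cmap_inv a (1 *\<^sub>R z))) * (1 / c * 0) +
         1 * gcos2 s (snd (Cmap_inv a (1 *\<^sub>R z))) * (- (a / pi) * 1 / c * 1))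
        (1 * g * gcos2 s (fst (Cmap_inv a (1 *\<^sub>R z))) * (0 * 0) +
         1 * gcos2 s (snd (Cmap_inv a (1 *\<^sub>R z))) * (1 * 1)) +
        mu0 * (1 * Usum s g (Cmap_inv a (1 *\<^sub>R z))) \<le> 0"
      using pucci_Usum_le[OF s0 less_imp_le[OF g0] assms(6) c_def assms(1,2) Lam z]
      by (simp add: mu0_def)
  qed (use assms(1) in simp)
  have bdry: "u_wga w g a z = 0" if "z \<in> frontier \<Omega>" for z
  proof -
    have z: "z \<in> closure \<Omega>" "z \<notin> \<Omega>" using that op by (auto simp: frontier_def interior_open)
    have "closure \<Omega> \<subseteq> Omega_star_closed s g a"
      using sub closed_Omega_star_closed[OF s0 assms(6)] by (rule closure_minimal)
    then have "z \<in> Omega_star_closed s g a" using z by blast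
    then show ?thesis
      using u Omega_star_boundary[OF s1 g _ z(2)[unfolded \<Omega>_def]] by (simp add: U_def)
  qed
  have cont: "continuous_on \<Omega> (u_wga w g a)"
  proof -
    have "continuous_on \<Omega> (\<lambda>z. Usum s g (Cmap_inv a z))"
      by (rule continuous_on_compose2[OF continuous_on_Usum[OF s0, of UNIV] continuous_on_Cmap_inv[OF assms(6)]]) simp
    then show ?thesis by (rule continuous_on_eq) (use u sub in \<open>auto simp: U_def\<close>)
  qed
  let ?A = "{mu. \<exists>phi. continuous_on \<Omega> phi \<and> (\<forall>z\<in>\<Omega>. phi z > 0) \<and> visc_supersol lam Lam mu \<Omega> phi}"
  have mem: "ereal mu \<le> principal_eig lam Lam \<Omega>" if "mu \<in> ?A" for mu
    unfolding principal_eig_def using that by (intro Sup_upper imageI)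
  have ge: "ereal mu0 \<le> principal_eig lam Lam \<Omega>" using cont pos super by (intro mem) blast
  have "principal_eig lam Lam \<Omega> = ereal mu0 \<longleftrightarrow> w = 1 \<or> a = 0"
  proof
    assume "w = 1 \<or> a = 0"
    then have triv: "s = 1 \<or> a = 0" by (auto simp: s_def)
    have "principal_eig lam Lam \<Omega> \<le> ereal mu0"
      unfolding principal_eig_def
    proof (rule Sup_least)
      fix m assume "m \<in> ereal ` ?A"
      then obtain mu phi where m: "m = ereal mu" "continuous_on \<Omega> phi" "\<forall>z\<in>\<Omega>. phi z > 0"
        "visc_supersol lam Lam mu \<Omega> phi" by blast
      have "mu \<le> mu0"
        unfolding mu0_def using m(2-4) unfolding \<Omega>_def
        by (intro supersol_le_eigenvalue[OF s1 g assms(6) c_def assms(1) Lam triv, of phi]) auto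
      then show "m \<le> ereal mu0" by (simp add: m(1))
    qed
    then show "principal_eig lam Lam \<Omega> = ereal mu0" using ge by (rule antisym)
  next
    assume eq: "principal_eig lam Lam \<Omega> = ereal mu0"
    show "w = 1 \<or> a = 0"
    proof (rule ccontr)
      assume n: "\<not> (w = 1 \<or> a = 0)"
      then have s: "1 < s" using w1 by (simp add: s_def)
      obtain mu phi where m: "mu0 < mu" "continuous_on \<Omega> phi" "\<forall>z\<in>\<Omega>. 0 < phi z"
        "visc_supersol lam Lam mu \<Omega> phi"
        using strict_supersol[OF s g assms(6) _ c_def assms(1) Lam] n unfolding mu0_def \<Omega>_def by blast
      then have "ereal mu \<le> principal_eig lam Lam \<Omega>" by (intro mem) blast
      then show False using m(1) by (simp add: eq)
    qed
  qed
  then show ?thesis unfolding \<Omega> mu0 using super pos bdry ge by blast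
qed

end
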